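(* Let $\mathcal{A}$ be a $\operatorname{Hom}$-finite idempotent complete $\mathbb{F}_q$-linear additive category and let $\mathcal{E}$ be an $\operatorname{Ext}^1$-finite exact structure on $\mathcal{A}$. Then for each $\mathcal{E}$-valuation $w:\operatorname{Iso}(\mathcal{A})\to\mathbb{N}$, the associated graded algebra of the filtration induced by $w$ on the Hall algebra $\mathcal{H}(\mathcal{E})$ is the Hall algebra $\mathcal{H}(\mathcal{E}')$ for some exact structure $\mathcal{E}'\in[\mathcal{E}^{\mathrm{add}},\mathcal{E}]$.
   Context: All categories are essentially small; $\mathbb{N}$ contains $0$; $\operatorname{Iso}(\mathcal{A})$ is the set of isomorphism classes of objects of $\mathcal{A}$. An exact structure on $\mathcal{A}$ is a Quillen exact structure, i.e. a class of kernel-cokernel pairs, called conflations, closed under isomorphism and satisfying Quillen's axioms. Exact structures are ordered by inclusion of classes of conflations; $\mathcal{E}^{\mathrm{add}}$ is the split (minimal) exact structure, and $[\mathcal{E}^{\mathrm{add}},\mathcal{E}]$ is the set of exact structures $\mathcal{E}'$ with $\mathcal{E}^{\mathrm{add}}\le\mathcal{E}'\le\mathcal{E}$. $\mathcal{E}$ is $\operatorname{Ext}^1$-finite if all spaces $\operatorname{Ext}^1_{\mathcal{E}}(A,B)$ are finite. Hall algebra: for an $\operatorname{Ext}^1$-finite exact structure $\mathcal{E}$, $\mathcal{H}(\mathcal{E})$ is the $\mathbb{Q}$-vector space with basis $\{[A]\mid A\in\operatorname{Iso}(\mathcal{A})\}$ and multiplication $$[A]\diamond[C]=\sum_{B\in\operatorname{Iso}(\mathcal{A})}\frac{|\operatorname{Ext}^1_{\mathcal{E}}(A,C)_B|}{|\operatorname{Hom}(A,C)|}[B],$$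 where $\operatorname{Ext}^1_{\mathcal{E}}(A,C)_B$ is the set of classes of conflations $C\rightarrowtail B'\twoheadrightarrow A$ in $\mathcal{E}$ with $B'\cong B$. It is associative with unit $[0]$. A function $w:\operatorname{Iso}(\mathcal{A})\to\mathbb{N}$ is an $\mathcal{E}$-valuation if $w(X)\le w(M\oplus N)$ whenever there is a conflation $N\rightarrowtail X\twoheadrightarrow M$ in $\mathcal{E}$, and $w(M\oplus N)=w(M)+w(N)$ for all $M,N$. The filtration induced by $w$ on $\mathcal{H}(\mathcal{E})$ has $n$-th term the span of the $[M]$ with $w(M)\le n$. The equality of the associated graded algebra with $\mathcal{H}(\mathcal{E}')$ is understood via the identification of the class of $[M]$ in degree $w(M)$ with the basis element $[M]$ of $\mathcal{H}(\mathcal{E}')$. *)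

theory Defs
  imports Complex_Main "HOL-Algebra.Module" "HOL-Algebra.QuotRing" "HOL-Library.Poly_Mapping"
begin

section \<open>Linear additive categories\<close>

text \<open>
  The space of morphisms from \<open>A\<close> to \<open>B\<close> is the module \<open>HomSp C A B\<close> (its ring multiplication
  and unit fields are not used); \<open>g \<star> f\<close> is \<open>g\<close> after \<open>f\<close>. Different morphism spaces are not
  required to be disjoint, so every notion below carries the endpoints of its morphisms.
\<close>

record ('o, 'm, 'k) lin_cat =
  Ob :: "'o set"
  HomSp :: "'o \<Rightarrow> 'o \<Rightarrow> ('k, 'm) module"
  Comp :: "'m \<Rightarrow> 'm \<Rightarrow> 'm" (infixl \<open>\<star>\<index>\<close> 70)
  Idn :: "'o \<Rightarrow> 'm"

abbreviation Mor :: "('o, 'm, 'k) lin_cat \<Rightarrow> 'o \<Rightarrow> 'o \<Rightarrow> 'm set" where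
  "Mor C A B \<equiv> carrier (HomSp C A B)"

locale linear_category =
  fixes K :: "'k ring" and C :: "('o, 'm, 'k) lin_cat"
  assumes field_K: "field K"
    and hom_space: "A \<in> Ob C \<Longrightarrow> B \<in> Ob C \<Longrightarrow> Module.module K (HomSp C A B)"
    and id_in: "A \<in> Ob C \<Longrightarrow> Idn C A \<in> Mor C A A"
    and comp_in: "\<lbrakk>X \<in> Ob C; Y \<in> Ob C; Z \<in> Ob C; f \<in> Mor C X Y; g \<in> Mor C Y Z\<rbrakk>
      \<Longrightarrow> g \<star>\<^bsub>C\<^esub> f \<in> Mor C X Z"
    and comp_assoc: "\<lbrakk>W \<in> Ob C; X \<in> Ob C; Y \<in> Ob C; Z \<in> Ob C;
        f \<in> Mor C W X; g \<in> Mor C X Y; h \<in> Mor C Y Z\<rbrakk>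
      \<Longrightarrow> h \<star>\<^bsub>C\<^esub> (g \<star>\<^bsub>C\<^esub> f) = (h \<star>\<^bsub>C\<^esub> g) \<star>\<^bsub>C\<^esub> f"
    and id_left: "\<lbrakk>X \<in> Ob C; Y \<in> Ob C; f \<in> Mor C X Y\<rbrakk> \<Longrightarrow> Idn C Y \<star>\<^bsub>C\<^esub> f = f"
    and id_right: "\<lbrakk>X \<in> Ob C; Y \<in> Ob C; f \<in> Mor C X Y\<rbrakk> \<Longrightarrow> f \<star>\<^bsub>C\<^esub> Idn C X = f"
    and comp_add_right: "\<lbrakk>X \<in> Ob C; Y \<in> Ob C; Z \<in> Ob C;
        f \<in> Mor C X Y; f' \<in> Mor C X Y; g \<in> Mor C Y Z\<rbrakk>
      \<Longrightarrow> g \<star>\<^bsub>C\<^esub> (f \<oplus>\<^bsub>HomSp C X Y\<^esub> f') = (g \<star>\<^bsub>C\<^esub> f) \<oplus>\<^bsub>HomSp C X Z\<^esub> (g \<star>\<^bsub>C\<^esub> f')"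
    and comp_add_left: "\<lbrakk>X \<in> Ob C; Y \<in> Ob C; Z \<in> Ob C;
        f \<in> Mor C X Y; g \<in> Mor C Y Z; g' \<in> Mor C Y Z\<rbrakk>
      \<Longrightarrow> (g \<oplus>\<^bsub>HomSp C Y Z\<^esub> g') \<star>\<^bsub>C\<^esub> f = (g \<star>\<^bsub>C\<^esub> f) \<oplus>\<^bsub>HomSp C X Z\<^esub> (g' \<star>\<^bsub>C\<^esub> f)"
    and comp_smult_right: "\<lbrakk>X \<in> Ob C; Y \<in> Ob C; Z \<in> Ob C;
        c \<in> carrier K; f \<in> Mor C X Y; g \<in> Mor C Y Z\<rbrakk>
      \<Longrightarrow> g \<star>\<^bsub>C\<^esub> (c \<odot>\<^bsub>HomSp C X Y\<^esub> f) = c \<odot>\<^bsub>HomSp C X Z\<^esub> (g \<star>\<^bsub>C\<^esub> f)"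
    and comp_smult_left: "\<lbrakk>X \<in> Ob C; Y \<in> Ob C; Z \<in> Ob C;
        c \<in> carrier K; f \<in> Mor C X Y; g \<in> Mor C Y Z\<rbrakk>
      \<Longrightarrow> (c \<odot>\<^bsub>HomSp C Y Z\<^esub> g) \<star>\<^bsub>C\<^esub> f = c \<odot>\<^bsub>HomSp C X Z\<^esub> (g \<star>\<^bsub>C\<^esub> f)"

abbreviation zero_mor :: "('o, 'm, 'k) lin_cat \<Rightarrow> 'o \<Rightarrow> 'o \<Rightarrow> 'm" where
  "zero_mor C A B \<equiv> \<zero>\<^bsub>HomSp C A B\<^esub>"

definition is_iso :: "('o, 'm, 'k) lin_cat \<Rightarrow> 'o \<Rightarrow> 'o \<Rightarrow> 'm \<Rightarrow> bool" where
  "is_iso C A B f \<longleftrightarrow> f \<in> Mor C A B \<and>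
    (\<exists>g \<in> Mor C B A. g \<star>\<^bsub>C\<^esub> f = Idn C A \<and> f \<star>\<^bsub>C\<^esub> g = Idn C B)"

definition isomorphic :: "('o, 'm, 'k) lin_cat \<Rightarrow> 'o \<Rightarrow> 'o \<Rightarrow> bool" where
  "isomorphic C A B \<longleftrightarrow> A \<in> Ob C \<and> B \<in> Ob C \<and> (\<exists>f. is_iso C A B f)"

definition iso_class :: "('o, 'm, 'k) lin_cat \<Rightarrow> 'o \<Rightarrow> 'o set" where
  "iso_class C A = {B. isomorphic C A B}"

definition Iso :: "('o, 'm, 'k) lin_cat \<Rightarrow> 'o set set" where
  "Iso C = iso_class C ` Ob C"

definition zero_object :: "('o, 'm, 'k) lin_cat \<Rightarrow> 'o \<Rightarrow> bool" where
  "zero_object C Z \<longleftrightarrow> Z \<in> Ob C \<and>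
    (\<forall>A \<in> Ob C. (\<exists>!f. f \<in> Mor C Z A) \<and> (\<exists>!f. f \<in> Mor C A Z))"

definition biproduct ::
    "('o, 'm, 'k) lin_cat \<Rightarrow> 'o \<Rightarrow> 'o \<Rightarrow> 'o \<Rightarrow> 'm \<Rightarrow> 'm \<Rightarrow> 'm \<Rightarrow> 'm \<Rightarrow> bool" where
  "biproduct C M N S i\<^sub>1 i\<^sub>2 p\<^sub>1 p\<^sub>2 \<longleftrightarrow>
    M \<in> Ob C \<and> N \<in> Ob C \<and> S \<in> Ob C \<and>
    i\<^sub>1 \<in> Mor C M S \<and> i\<^sub>2 \<in> Mor C N S \<and> p\<^sub>1 \<in> Mor C S M \<and> p\<^sub>2 \<in> Mor C S N \<and>
    p\<^sub>1 \<star>\<^bsub>C\<^esub> i\<^sub>1 = Idn C M \<and> p\<^sub>2 \<star>\<^bsub>C\<^esub> i\<^sub>2 = Idn C N \<and>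
    p\<^sub>1 \<star>\<^bsub>C\<^esub> i\<^sub>2 = zero_mor C N M \<and> p\<^sub>2 \<star>\<^bsub>C\<^esub> i\<^sub>1 = zero_mor C M N \<and>
    (i\<^sub>1 \<star>\<^bsub>C\<^esub> p\<^sub>1) \<oplus>\<^bsub>HomSp C S S\<^esub> (i\<^sub>2 \<star>\<^bsub>C\<^esub> p\<^sub>2) = Idn C S"

definition direct_sum :: "('o, 'm, 'k) lin_cat \<Rightarrow> 'o \<Rightarrow> 'o \<Rightarrow> 'o \<Rightarrow> bool" where
  "direct_sum C M N S \<longleftrightarrow> (\<exists>i\<^sub>1 i\<^sub>2 p\<^sub>1 p\<^sub>2. biproduct C M N S i\<^sub>1 i\<^sub>2 p\<^sub>1 p\<^sub>2)"

locale linear_additive_category = linear_category K C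
  for K :: "'k ring" and C :: "('o, 'm, 'k) lin_cat" +
  assumes ex_zero_object: "\<exists>Z. zero_object C Z"
    and ex_direct_sum: "M \<in> Ob C \<Longrightarrow> N \<in> Ob C \<Longrightarrow> \<exists>S. direct_sum C M N S"

definition idempotent_complete :: "('o, 'm, 'k) lin_cat \<Rightarrow> bool" where
  "idempotent_complete C \<longleftrightarrow>
    (\<forall>A \<in> Ob C. \<forall>e \<in> Mor C A A. e \<star>\<^bsub>C\<^esub> e = e \<longrightarrow>
      (\<exists>B \<in> Ob C. \<exists>r \<in> Mor C A B. \<exists>s \<in> Mor C B A.
        s \<star>\<^bsub>C\<^esub> r = e \<and> r \<star>\<^bsub>C\<^esub> s = Idn C B))"

text \<open>Over a finite field, finite-dimensional morphism spaces are the same as finite ones.\<close>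

definition hom_finite :: "('o, 'm, 'k) lin_cat \<Rightarrow> bool" where
  "hom_finite C \<longleftrightarrow> (\<forall>A \<in> Ob C. \<forall>B \<in> Ob C. finite (Mor C A B))"

section \<open>Exact structures\<close>

text \<open>The tuple \<open>(X, i, Y, p, Z)\<close> stands for the pair \<open>i : X \<rightarrow> Y\<close>, \<open>p : Y \<rightarrow> Z\<close>.\<close>

type_synonym ('o, 'm) seq = "'o \<times> 'm \<times> 'o \<times> 'm \<times> 'o"

definition is_kernel :: "('o, 'm, 'k) lin_cat \<Rightarrow> 'o \<Rightarrow> 'm \<Rightarrow> 'o \<Rightarrow> 'm \<Rightarrow> 'o \<Rightarrow> bool" where
  "is_kernel C X i Y p Z \<longleftrightarrow> p \<star>\<^bsub>C\<^esub> i = zero_mor C X Z \<and>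
    (\<forall>T \<in> Ob C. \<forall>f \<in> Mor C T Y. p \<star>\<^bsub>C\<^esub> f = zero_mor C T Z \<longrightarrow>
      (\<exists>!g. g \<in> Mor C T X \<and> i \<star>\<^bsub>C\<^esub> g = f))"

definition is_cokernel :: "('o, 'm, 'k) lin_cat \<Rightarrow> 'o \<Rightarrow> 'm \<Rightarrow> 'o \<Rightarrow> 'm \<Rightarrow> 'o \<Rightarrow> bool" where
  "is_cokernel C X i Y p Z \<longleftrightarrow> p \<star>\<^bsub>C\<^esub> i = zero_mor C X Z \<and>
    (\<forall>T \<in> Ob C. \<forall>f \<in> Mor C Y T. f \<star>\<^bsub>C\<^esub> i = zero_mor C X T \<longrightarrow>
      (\<exists>!g. g \<in> Mor C Z T \<and> g \<star>\<^bsub>C\<^esub> p = f))"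

definition kernel_cokernel_pairs :: "('o, 'm, 'k) lin_cat \<Rightarrow> ('o, 'm) seq set" where
  "kernel_cokernel_pairs C = {(X, i, Y, p, Z) | X i Y p Z.
    X \<in> Ob C \<and> Y \<in> Ob C \<and> Z \<in> Ob C \<and> i \<in> Mor C X Y \<and> p \<in> Mor C Y Z \<and>
    is_kernel C X i Y p Z \<and> is_cokernel C X i Y p Z}"

definition admissible_mono :: "('o, 'm) seq set \<Rightarrow> 'o \<Rightarrow> 'm \<Rightarrow> 'o \<Rightarrow> bool" where
  "admissible_mono E X i Y \<longleftrightarrow> (\<exists>p Z. (X, i, Y, p, Z) \<in> E)"

definition admissible_epi :: "('o, 'm) seq set \<Rightarrow> 'o \<Rightarrow> 'm \<Rightarrow> 'o \<Rightarrow> bool" where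
  "admissible_epi E Y p Z \<longleftrightarrow> (\<exists>X i. (X, i, Y, p, Z) \<in> E)"

text \<open>\<open>pushout C X i Y f X' i' Y' f'\<close>: the square of \<open>i : X \<rightarrow> Y\<close>, \<open>f : X \<rightarrow> X'\<close>,
  \<open>i' : X' \<rightarrow> Y'\<close>, \<open>f' : Y \<rightarrow> Y'\<close> is a pushout.\<close>

definition pushout ::
    "('o, 'm, 'k) lin_cat \<Rightarrow> 'o \<Rightarrow> 'm \<Rightarrow> 'o \<Rightarrow> 'm \<Rightarrow> 'o \<Rightarrow> 'm \<Rightarrow> 'o \<Rightarrow> 'm \<Rightarrow> bool" where
  "pushout C X i Y f X' i' Y' f' \<longleftrightarrow>
    X \<in> Ob C \<and> Y \<in> Ob C \<and> X' \<in> Ob C \<and> Y' \<in> Ob C \<and>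
    i \<in> Mor C X Y \<and> f \<in> Mor C X X' \<and> i' \<in> Mor C X' Y' \<and> f' \<in> Mor C Y Y' \<and>
    f' \<star>\<^bsub>C\<^esub> i = i' \<star>\<^bsub>C\<^esub> f \<and>
    (\<forall>T \<in> Ob C. \<forall>u \<in> Mor C Y T. \<forall>v \<in> Mor C X' T. u \<star>\<^bsub>C\<^esub> i = v \<star>\<^bsub>C\<^esub> f \<longrightarrow>
      (\<exists>!t. t \<in> Mor C Y' T \<and> t \<star>\<^bsub>C\<^esub> f' = u \<and> t \<star>\<^bsub>C\<^esub> i' = v))"

text \<open>\<open>pullback C Y p Z f Z' p' Y' f'\<close>: the square of \<open>p : Y \<rightarrow> Z\<close>, \<open>f : Z' \<rightarrow> Z\<close>,
  \<open>p' : Y' \<rightarrow> Z'\<close>, \<open>f' : Y' \<rightarrow> Y\<close> is a pullback.\<close>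

definition pullback ::
    "('o, 'm, 'k) lin_cat \<Rightarrow> 'o \<Rightarrow> 'm \<Rightarrow> 'o \<Rightarrow> 'm \<Rightarrow> 'o \<Rightarrow> 'm \<Rightarrow> 'o \<Rightarrow> 'm \<Rightarrow> bool" where
  "pullback C Y p Z f Z' p' Y' f' \<longleftrightarrow>
    Y \<in> Ob C \<and> Z \<in> Ob C \<and> Z' \<in> Ob C \<and> Y' \<in> Ob C \<and>
    p \<in> Mor C Y Z \<and> f \<in> Mor C Z' Z \<and> p' \<in> Mor C Y' Z' \<and> f' \<in> Mor C Y' Y \<and>
    p \<star>\<^bsub>C\<^esub> f' = f \<star>\<^bsub>C\<^esub> p' \<and>
    (\<forall>T \<in> Ob C. \<forall>u \<in> Mor C T Y. \<forall>v \<in> Mor C T Z'. p \<star>\<^bsub>C\<^esub> u = f \<star>\<^bsub>C\<^esub> v \<longrightarrow>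
      (\<exists>!t. t \<in> Mor C T Y' \<and> f' \<star>\<^bsub>C\<^esub> t = u \<and> p' \<star>\<^bsub>C\<^esub> t = v))"

definition seq_iso :: "('o, 'm, 'k) lin_cat \<Rightarrow> ('o, 'm) seq \<Rightarrow> ('o, 'm) seq \<Rightarrow> bool" where
  "seq_iso C = (\<lambda>(X, i, Y, p, Z) (X', i', Y', p', Z').
    \<exists>a b c. is_iso C X X' a \<and> is_iso C Y Y' b \<and> is_iso C Z Z' c \<and>
      b \<star>\<^bsub>C\<^esub> i = i' \<star>\<^bsub>C\<^esub> a \<and> c \<star>\<^bsub>C\<^esub> p = p' \<star>\<^bsub>C\<^esub> b)"

definition exact_structure :: "('o, 'm, 'k) lin_cat \<Rightarrow> ('o, 'm) seq set \<Rightarrow> bool" where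
  "exact_structure C E \<longleftrightarrow>
    E \<subseteq> kernel_cokernel_pairs C \<and>
    (\<forall>s \<in> E. \<forall>t \<in> kernel_cokernel_pairs C. seq_iso C s t \<longrightarrow> t \<in> E) \<and>
    (\<forall>A \<in> Ob C. admissible_mono E A (Idn C A) A) \<and>
    (\<forall>A \<in> Ob C. admissible_epi E A (Idn C A) A) \<and>
    (\<forall>X i Y j Z. admissible_mono E X i Y \<and> admissible_mono E Y j Z \<longrightarrow>
      admissible_mono E X (j \<star>\<^bsub>C\<^esub> i) Z) \<and>
    (\<forall>X p Y q Z. admissible_epi E X p Y \<and> admissible_epi E Y q Z \<longrightarrow>
      admissible_epi E X (q \<star>\<^bsub>C\<^esub> p) Z) \<and>
    (\<forall>X i Y. \<forall>X' \<in> Ob C. \<forall>f \<in> Mor C X X'. admissible_mono E X i Y \<longrightarrow>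
      (\<exists>i' Y' f'. pushout C X i Y f X' i' Y' f' \<and> admissible_mono E X' i' Y')) \<and>
    (\<forall>Y p Z. \<forall>Z' \<in> Ob C. \<forall>f \<in> Mor C Z' Z. admissible_epi E Y p Z \<longrightarrow>
      (\<exists>p' Y' f'. pullback C Y p Z f Z' p' Y' f' \<and> admissible_epi E Y' p' Z'))"

text \<open>The conflations of the minimal exact structure are the split sequences
  \<open>N \<rightarrow> N \<oplus> M \<rightarrow> M\<close>.\<close>

definition E_add :: "('o, 'm, 'k) lin_cat \<Rightarrow> ('o, 'm) seq set" where
  "E_add C = {(N, i, X, p, M) | N i X p M. \<exists>r s. biproduct C N M X i s r p}"

definition exact_interval ::
    "('o, 'm, 'k) lin_cat \<Rightarrow> ('o, 'm) seq set \<Rightarrow> ('o, 'm) seq set \<Rightarrow> ('o, 'm) seq set set" where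
  "exact_interval C E\<^sub>1 E\<^sub>2 = {E. exact_structure C E \<and> E\<^sub>1 \<subseteq> E \<and> E \<subseteq> E\<^sub>2}"

section \<open>Extensions\<close>

text \<open>The triple \<open>(i, B, p)\<close> represents the conflation \<open>N \<rightarrow> B \<rightarrow> A\<close>.\<close>

definition extensions :: "('o, 'm) seq set \<Rightarrow> 'o \<Rightarrow> 'o \<Rightarrow> ('m \<times> 'o \<times> 'm) set" where
  "extensions E A N = {(i, B, p) | i B p. (N, i, B, p, A) \<in> E}"

definition ext_equiv :: "('o, 'm, 'k) lin_cat \<Rightarrow> ('o, 'm) seq set \<Rightarrow> 'o \<Rightarrow> 'o \<Rightarrow>
    (('m \<times> 'o \<times> 'm) \<times> ('m \<times> 'o \<times> 'm)) set" where
  "ext_equiv C E A N = {((i, B, p), (i', B', p')) | i B p i' B' p'.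
    (i, B, p) \<in> extensions E A N \<and> (i', B', p') \<in> extensions E A N \<and>
    (\<exists>h. is_iso C B B' h \<and> h \<star>\<^bsub>C\<^esub> i = i' \<and> p' \<star>\<^bsub>C\<^esub> h = p)}"

definition Ext1 ::
    "('o, 'm, 'k) lin_cat \<Rightarrow> ('o, 'm) seq set \<Rightarrow> 'o \<Rightarrow> 'o \<Rightarrow> ('m \<times> 'o \<times> 'm) set set" where
  "Ext1 C E A N = extensions E A N // ext_equiv C E A N"

definition Ext1_mid ::
    "('o, 'm, 'k) lin_cat \<Rightarrow> ('o, 'm) seq set \<Rightarrow> 'o \<Rightarrow> 'o \<Rightarrow> 'o \<Rightarrow> ('m \<times> 'o \<times> 'm) set set" where
  "Ext1_mid C E A N B = {\<xi> \<in> Ext1 C E A N. \<exists>(i, B', p) \<in> \<xi>. isomorphic C B' B}"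

definition ext1_finite :: "('o, 'm, 'k) lin_cat \<Rightarrow> ('o, 'm) seq set \<Rightarrow> bool" where
  "ext1_finite C E \<longleftrightarrow> (\<forall>A \<in> Ob C. \<forall>N \<in> Ob C. finite (Ext1 C E A N))"

section \<open>The Hall algebra\<close>

text \<open>The vector space on \<open>Iso C\<close> consists of the finitely supported rational functions on
  isomorphism classes; \<open>Poly_Mapping.single (iso_class C A) 1\<close> is the basis element \<open>[A]\<close>.
  The convolution product that the library puts on this type is not used.\<close>

definition hall_scale :: "rat \<Rightarrow> ('o set \<Rightarrow>\<^sub>0 rat) \<Rightarrow> ('o set \<Rightarrow>\<^sub>0 rat)" where
  "hall_scale q f = Poly_Mapping.map (\<lambda>x. q * x) f"

definition hall_basis :: "('o, 'm, 'k) lin_cat \<Rightarrow> 'o \<Rightarrow> ('o set \<Rightarrow>\<^sub>0 rat)" where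
  "hall_basis C A = Poly_Mapping.single (iso_class C A) 1"

definition rep :: "'o set \<Rightarrow> 'o" where
  "rep a = (SOME A. A \<in> a)"

definition hall_coeff :: "('o, 'm, 'k) lin_cat \<Rightarrow> ('o, 'm) seq set \<Rightarrow> 'o \<Rightarrow> 'o \<Rightarrow> 'o \<Rightarrow> rat" where
  "hall_coeff C E A N B = of_nat (card (Ext1_mid C E A N B)) / of_nat (card (Mor C A N))"

text \<open>The sum over all of \<open>Iso C\<close> is restricted to the classes of middle terms, all others having
  coefficient zero; for a finite extension space only finitely many classes remain.\<close>

definition hall_basis_mult ::
    "('o, 'm, 'k) lin_cat \<Rightarrow> ('o, 'm) seq set \<Rightarrow> 'o \<Rightarrow> 'o \<Rightarrow> ('o set \<Rightarrow>\<^sub>0 rat)" where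
  "hall_basis_mult C E A N =
    (\<Sum>b \<in> {b \<in> Iso C. Ext1_mid C E A N (rep b) \<noteq> {}}.
      Poly_Mapping.single b (hall_coeff C E A N (rep b)))"

definition hall_mult :: "('o, 'm, 'k) lin_cat \<Rightarrow> ('o, 'm) seq set \<Rightarrow>
    ('o set \<Rightarrow>\<^sub>0 rat) \<Rightarrow> ('o set \<Rightarrow>\<^sub>0 rat) \<Rightarrow> ('o set \<Rightarrow>\<^sub>0 rat)" where
  "hall_mult C E f g =
    (\<Sum>a \<in> Poly_Mapping.keys f. \<Sum>c \<in> Poly_Mapping.keys g.
      hall_scale (Poly_Mapping.lookup f a * Poly_Mapping.lookup g c)
        (hall_basis_mult C E (rep a) (rep c)))"

definition hall_algebra ::
    "('o, 'm, 'k) lin_cat \<Rightarrow> ('o, 'm) seq set \<Rightarrow> (rat, 'o set \<Rightarrow>\<^sub>0 rat) module" where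
  "hall_algebra C E =
    \<lparr>carrier = {f. Poly_Mapping.keys f \<subseteq> Iso C},
     monoid.mult = hall_mult C E,
     one = hall_basis C (SOME Z. zero_object C Z),
     zero = 0,
     add = (+),
     smult = hall_scale\<rparr>"

section \<open>Valuations and associated graded algebras\<close>

definition valuation ::
    "('o, 'm, 'k) lin_cat \<Rightarrow> ('o, 'm) seq set \<Rightarrow> ('o set \<Rightarrow> nat) \<Rightarrow> bool" where
  "valuation C E w \<longleftrightarrow>
    (\<forall>N i X p M S. (N, i, X, p, M) \<in> E \<and> direct_sum C M N S \<longrightarrow>
      w (iso_class C X) \<le> w (iso_class C S)) \<and>
    (\<forall>M N S. direct_sum C M N S \<longrightarrow>
      w (iso_class C S) = w (iso_class C M) + w (iso_class C N))"

definition hall_filtration ::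
    "('o, 'm, 'k) lin_cat \<Rightarrow> ('o set \<Rightarrow> nat) \<Rightarrow> nat \<Rightarrow> ('o set \<Rightarrow>\<^sub>0 rat) set" where
  "hall_filtration C w n =
    Modules.module.span hall_scale {hall_basis C M | M. M \<in> Ob C \<and> w (iso_class C M) \<le> n}"

definition algebra_filtration :: "(rat, 'h) module \<Rightarrow> (nat \<Rightarrow> 'h set) \<Rightarrow> bool" where
  "algebra_filtration H F \<longleftrightarrow>
    (\<forall>n. subgroup (F n) (add_monoid H)) \<and>
    (\<forall>n c. \<forall>x \<in> F n. c \<odot>\<^bsub>H\<^esub> x \<in> F n) \<and>
    (\<forall>n. F n \<subseteq> F (Suc n)) \<and>
    (\<Union>n. F n) = carrier H \<and>
    \<one>\<^bsub>H\<^esub> \<in> F 0 \<and>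
    (\<forall>m n. \<forall>x \<in> F m. \<forall>y \<in> F n. x \<otimes>\<^bsub>H\<^esub> y \<in> F (m + n))"

definition prev :: "(rat, 'h) module \<Rightarrow> (nat \<Rightarrow> 'h set) \<Rightarrow> nat \<Rightarrow> 'h set" where
  "prev H F n = (case n of 0 \<Rightarrow> {\<zero>\<^bsub>H\<^esub>} | Suc m \<Rightarrow> F m)"

definition gr_class :: "(rat, 'h) module \<Rightarrow> (nat \<Rightarrow> 'h set) \<Rightarrow> nat \<Rightarrow> 'h \<Rightarrow> 'h set" where
  "gr_class H F n x = prev H F n +>\<^bsub>H\<^esub> x"

text \<open>An element of the direct sum of the quotients \<open>F n / prev n\<close> is the family of its
  components, which are cosets. The degree \<open>n\<close> component of a product is the sum of cosets
  \<open>\<Sum>i \<le> n. \<xi> i \<eta> (n - i)\<close>, written as the set of all sums of elements of these.\<close>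

definition assoc_graded ::
    "(rat, 'h) module \<Rightarrow> (nat \<Rightarrow> 'h set) \<Rightarrow> (rat, nat \<Rightarrow> 'h set) module" where
  "assoc_graded H F =
    \<lparr>carrier = {\<xi>. (\<forall>n. \<xi> n \<in> gr_class H F n ` F n) \<and> finite {n. \<xi> n \<noteq> prev H F n}},
     monoid.mult = (\<lambda>\<xi> \<eta> n. {finsum H z {..n} | z.
       \<forall>i \<le> n. z i \<in> rcoset_mult H (prev H F n) (\<xi> i) (\<eta> (n - i))}),
     one = (\<lambda>n. if n = 0 then gr_class H F 0 \<one>\<^bsub>H\<^esub> else prev H F n),
     zero = prev H F,
     add = (\<lambda>\<xi> \<eta> n. \<xi> n <+>\<^bsub>H\<^esub> \<eta> n),
     smult = (\<lambda>c \<xi> n. \<Union>x \<in> \<xi> n. gr_class H F n (c \<odot>\<^bsub>H\<^esub> x))\<rparr>"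

definition gr_homogeneous :: "(rat, 'h) module \<Rightarrow> (nat \<Rightarrow> 'h set) \<Rightarrow> nat \<Rightarrow> 'h \<Rightarrow> nat \<Rightarrow> 'h set" where
  "gr_homogeneous H F d x = (\<lambda>n. if n = d then gr_class H F d x else prev H F n)"

definition algebra_iso :: "(rat, 'g) module \<Rightarrow> (rat, 'h) module \<Rightarrow> ('g \<Rightarrow> 'h) set" where
  "algebra_iso G H =
    {\<phi> \<in> ring_iso G H. \<forall>c. \<forall>x \<in> carrier G. \<phi> (c \<odot>\<^bsub>G\<^esub> x) = c \<odot>\<^bsub>H\<^esub> \<phi> x}"

end

theory Submission
  imports Defs
begin

text \<open>
  Let \<open>E'\<close> consist of the conflations \<open>N \<rightarrow> X \<rightarrow> M\<close> of \<open>E\<close> with \<open>w(X) = w(M) + w(N)\<close>. Every middle term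
  \<open>B\<close> of an extension of \<open>A\<close> by \<open>N\<close> satisfies \<open>w(B) \<le> w(A) + w(N)\<close>, so the span of the classes of weight at
  most \<open>n\<close> is a multiplicative filtration, and modulo lower terms the product \<open>[A] \<diamond> [N]\<close> keeps
  precisely the classes \<open>[B]\<close> of weight \<open>w(A) + w(N)\<close>. Whether an extension lies in \<open>E'\<close> depends only on
  the isomorphism class of its middle term, so these terms carry the structure constants of \<open>E'\<close>
  (\<open>Ext1_mid_additive\<close>). Hence the associated graded algebra is the Hall algebra of \<open>E'\<close>; this half
  is linear algebra of a filtered basis (\<open>graded_map_iso\<close>).

  The categorical half is that \<open>E'\<close> is an exact structure (\<open>exact_additive\<close>). Given \<open>N \<rightarrow> Y \<rightarrow> Z\<close> in \<open>E'\<close>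
  and its pullback \<open>N \<rightarrow> Y' \<rightarrow> Z'\<close> along \<open>f : Z' \<rightarrow> Z\<close>, there is also a conflation
  \<open>Y' \<rightarrow> Y \<oplus> Z' \<rightarrow> Z\<close> in \<open>E\<close> (\<open>deflation_sum\<close>, \<open>pullback_kernel_of_difference\<close>). The valuation
  inequality for it reads \<open>w(Z) + w(N) + w(Z') \<le> w(Z) + w(Y')\<close>, so \<open>w(Y')\<close> is at least \<open>w(Z') + w(N)\<close>, and
  the inequality for the pulled back conflation gives equality (\<open>additive_pullback\<close>). For a composite
  \<open>X \<rightarrow> Y \<rightarrow> Z\<close> of deflations of \<open>E'\<close> with kernels \<open>A\<close> and \<open>B\<close>, the kernel \<open>D\<close> of the composite is the
  pullback of \<open>X \<rightarrow> Y\<close> along \<open>B \<rightarrow> Y\<close>, hence an extension of \<open>B\<close> by \<open>A\<close>, and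
  \<open>w(X) \<le> w(Z) + w(D) \<le> w(Z) + w(B) + w(A) = w(X)\<close> (\<open>additive_comp\<close>). The axioms for inflations are
  those for deflations in the opposite category, for which \<open>w\<close> is a valuation again.
\<close>

section \<open>Arrows, kernels and pullbacks in linear categories\<close>

text \<open>Morphism spaces may overlap, so an arrow is a morphism together with its endpoints.\<close>

definition arr :: "('o, 'm, 'k) lin_cat \<Rightarrow> 'm \<Rightarrow> 'o \<Rightarrow> 'o \<Rightarrow> bool" where
  "arr C f X Y \<longleftrightarrow> X \<in> Ob C \<and> Y \<in> Ob C \<and> f \<in> Mor C X Y"

lemma arr_ob: "arr C f X Y \<Longrightarrow> X \<in> Ob C" "arr C f X Y \<Longrightarrow> Y \<in> Ob C" "arr C f X Y \<Longrightarrow> f \<in> Mor C X Y"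
  by (simp_all add: arr_def)

context linear_category
begin

abbreviation cmp (infixl \<open>\<cdot>\<close> 70) where "g \<cdot> f \<equiv> g \<star>\<^bsub>C\<^esub> f"

abbreviation arrow where "arrow \<equiv> arr C"

lemma abelian_group_hom: "A \<in> Ob C \<Longrightarrow> B \<in> Ob C \<Longrightarrow> abelian_group (HomSp C A B)"
  using hom_space Module.module.axioms by blast

lemma arr_comp: "arrow f X Y \<Longrightarrow> arrow g Y Z \<Longrightarrow> arrow (g \<cdot> f) X Z"
  unfolding arr_def using comp_in by blast

lemma arr_id: "X \<in> Ob C \<Longrightarrow> arrow (Idn C X) X X"
  by (simp add: arr_def id_in)

lemma arr_zero: "X \<in> Ob C \<Longrightarrow> Y \<in> Ob C \<Longrightarrow> arrow (zero_mor C X Y) X Y"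
  by (simp add: arr_def abelian_groupE(2) abelian_group_hom)

lemma arr_add: "arrow f X Y \<Longrightarrow> arrow g X Y \<Longrightarrow> arrow (f \<oplus>\<^bsub>HomSp C X Y\<^esub> g) X Y"
  by (simp add: arr_def abelian_groupE(1) abelian_group_hom)

lemma arr_diff: "arrow f X Y \<Longrightarrow> arrow g X Y \<Longrightarrow> arrow (f \<ominus>\<^bsub>HomSp C X Y\<^esub> g) X Y"
  by (simp add: arr_def abelian_group.minus_closed abelian_group_hom)

lemma assoc: "arrow f W X \<Longrightarrow> arrow g X Y \<Longrightarrow> arrow h Y Z \<Longrightarrow> (h \<cdot> g) \<cdot> f = h \<cdot> (g \<cdot> f)"
  unfolding arr_def using comp_assoc[of W X Y Z f g h] by simp

lemma id_l: "arrow f X Y \<Longrightarrow> Idn C Y \<cdot> f = f"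
  and id_r: "arrow f X Y \<Longrightarrow> f \<cdot> Idn C X = f"
  unfolding arr_def using id_left id_right by blast+

lemma comp_add: "arrow f X Y \<Longrightarrow> arrow f' X Y \<Longrightarrow> arrow g Y Z
    \<Longrightarrow> g \<cdot> (f \<oplus>\<^bsub>HomSp C X Y\<^esub> f') = (g \<cdot> f) \<oplus>\<^bsub>HomSp C X Z\<^esub> (g \<cdot> f')"
  and add_comp: "arrow f X Y \<Longrightarrow> arrow g Y Z \<Longrightarrow> arrow g' Y Z
    \<Longrightarrow> (g \<oplus>\<^bsub>HomSp C Y Z\<^esub> g') \<cdot> f = (g \<cdot> f) \<oplus>\<^bsub>HomSp C X Z\<^esub> (g' \<cdot> f)"
  by (simp_all add: arr_def comp_add_left comp_add_right)

lemma comp_zero: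
  assumes g: "arrow g Y Z" and X: "X \<in> Ob C"
  shows "g \<cdot> zero_mor C X Y = zero_mor C X Z"
proof -
  have Y: "Y \<in> Ob C" and Z: "Z \<in> Ob C" using g by (simp_all add: arr_def)
  interpret XY: abelian_group "HomSp C X Y" using abelian_group_hom X Y by blast
  interpret XZ: abelian_group "HomSp C X Z" using abelian_group_hom X Z by blast
  have "g \<cdot> zero_mor C X Y \<in> Mor C X Z" using arr_comp[OF arr_zero[OF X Y] g] by (simp add: arr_def)
  moreover have "g \<cdot> zero_mor C X Y = g \<cdot> zero_mor C X Y \<oplus>\<^bsub>HomSp C X Z\<^esub> g \<cdot> zero_mor C X Y"
    using comp_add[OF arr_zero[OF X Y] arr_zero[OF X Y] g] by simp
  ultimately show ?thesis using XZ.add.l_cancel_one by metis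
qed

lemma zero_comp:
  assumes f: "arrow f X Y" and Z: "Z \<in> Ob C"
  shows "zero_mor C Y Z \<cdot> f = zero_mor C X Z"
proof -
  have X: "X \<in> Ob C" and Y: "Y \<in> Ob C" using f by (simp_all add: arr_def)
  interpret YZ: abelian_group "HomSp C Y Z" using abelian_group_hom Y Z by blast
  interpret XZ: abelian_group "HomSp C X Z" using abelian_group_hom X Z by blast
  have "zero_mor C Y Z \<cdot> f \<in> Mor C X Z" using arr_comp[OF f arr_zero[OF Y Z]] by (simp add: arr_def)
  moreover have "zero_mor C Y Z \<cdot> f = zero_mor C Y Z \<cdot> f \<oplus>\<^bsub>HomSp C X Z\<^esub> zero_mor C Y Z \<cdot> f"
    using add_comp[OF f arr_zero[OF Y Z] arr_zero[OF Y Z]] by simp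
  ultimately show ?thesis using XZ.add.l_cancel_one by metis
qed

lemma diff_comp:
  assumes f: "arrow f X Y" and g: "arrow g Y Z" and h: "arrow h Y Z"
  shows "(g \<ominus>\<^bsub>HomSp C Y Z\<^esub> h) \<cdot> f = (g \<cdot> f) \<ominus>\<^bsub>HomSp C X Z\<^esub> (h \<cdot> f)"
proof -
  have X: "X \<in> Ob C" and Y: "Y \<in> Ob C" and Z: "Z \<in> Ob C" using f g by (simp_all add: arr_def)
  interpret YZ: abelian_group "HomSp C Y Z" using abelian_group_hom Y Z by blast
  interpret XZ: abelian_group "HomSp C X Z" using abelian_group_hom X Z by blast
  let ?d = "g \<ominus>\<^bsub>HomSp C Y Z\<^esub> h"
  have gh: "g \<in> Mor C Y Z" "h \<in> Mor C Y Z" using g h by (simp_all add: arr_def)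
  have "?d \<oplus>\<^bsub>HomSp C Y Z\<^esub> h = g"
    using gh by (simp add: YZ.minus_eq YZ.a_assoc YZ.l_neg)
  then have e: "g \<cdot> f = (?d \<cdot> f) \<oplus>\<^bsub>HomSp C X Z\<^esub> (h \<cdot> f)"
    using add_comp[OF f arr_diff[OF g h] h] by simp
  have "?d \<cdot> f \<in> Mor C X Z" "h \<cdot> f \<in> Mor C X Z"
    using arr_comp[OF f arr_diff[OF g h]] arr_comp[OF f h] by (simp_all add: arr_def)
  then show ?thesis unfolding e by (simp add: XZ.minus_eq XZ.a_assoc XZ.r_neg)
qed

lemma diff_zero_iff:
  assumes "arrow g X Y" "arrow h X Y"
  shows "g \<ominus>\<^bsub>HomSp C X Y\<^esub> h = zero_mor C X Y \<longleftrightarrow> g = h"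
proof -
  interpret XY: abelian_group "HomSp C X Y" using abelian_group_hom assms by (simp add: arr_def)
  have "g = (g \<ominus>\<^bsub>HomSp C X Y\<^esub> h) \<oplus>\<^bsub>HomSp C X Y\<^esub> h" "h \<ominus>\<^bsub>HomSp C X Y\<^esub> h = zero_mor C X Y"
    using assms by (simp_all add: arr_def XY.minus_eq XY.a_assoc XY.l_neg XY.r_neg)
  then show ?thesis using assms by (metis XY.l_zero arr_def)
qed

lemma add_diff_cancel_right:
  assumes "arrow g X Y" "arrow h X Y"
  shows "(g \<oplus>\<^bsub>HomSp C X Y\<^esub> h) \<ominus>\<^bsub>HomSp C X Y\<^esub> h = g"
proof -
  interpret XY: abelian_group "HomSp C X Y" using abelian_group_hom assms by (simp add: arr_def)
  show ?thesis using assms by (simp add: arr_def XY.minus_eq XY.a_assoc XY.r_neg)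
qed

lemma is_isoI:
  assumes "arrow f X Y" "arrow g Y X" "g \<cdot> f = Idn C X" "f \<cdot> g = Idn C Y"
  shows "is_iso C X Y f"
  using assms by (auto simp: is_iso_def arr_def)

lemma is_isoE:
  assumes "is_iso C X Y f" "X \<in> Ob C" "Y \<in> Ob C"
  obtains g where "arrow f X Y" "arrow g Y X" "g \<cdot> f = Idn C X" "f \<cdot> g = Idn C Y" "is_iso C Y X g"
  using assms by (auto simp: is_iso_def arr_def)

lemma is_iso_id: "X \<in> Ob C \<Longrightarrow> is_iso C X X (Idn C X)"
  by (metis is_isoI arr_id id_l)

lemma is_iso_comp:
  assumes f: "is_iso C X Y f" and g: "is_iso C Y Z g" and "X \<in> Ob C" "Y \<in> Ob C" "Z \<in> Ob C"
  shows "is_iso C X Z (g \<cdot> f)"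
proof -
  obtain f' where f: "arrow f X Y" and f': "arrow f' Y X" and ff: "f' \<cdot> f = Idn C X" "f \<cdot> f' = Idn C Y"
    using is_isoE assms by metis
  obtain g' where g: "arrow g Y Z" and g': "arrow g' Z Y" and gg: "g' \<cdot> g = Idn C Y" "g \<cdot> g' = Idn C Z"
    using is_isoE assms by metis
  have "(f' \<cdot> g') \<cdot> (g \<cdot> f) = f' \<cdot> ((g' \<cdot> g) \<cdot> f)"
    using assoc[OF arr_comp[OF f g] g' f'] assoc[OF f g g'] by simp
  also have "\<dots> = Idn C X" using ff gg id_l f by simp
  finally have 1: "(f' \<cdot> g') \<cdot> (g \<cdot> f) = Idn C X" .
  have "(g \<cdot> f) \<cdot> (f' \<cdot> g') = g \<cdot> ((f \<cdot> f') \<cdot> g')"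
    using assoc[OF arr_comp[OF g' f'] f g] assoc[OF g' f' f] by simp
  also have "\<dots> = Idn C Z" using ff gg id_l g' by simp
  finally show ?thesis using is_isoI[OF arr_comp[OF f g] arr_comp[OF g' f'] 1] by blast
qed

lemma isomorphic_refl: "X \<in> Ob C \<Longrightarrow> isomorphic C X X"
  using is_iso_id by (auto simp: isomorphic_def)

lemma isomorphic_sym: "isomorphic C X Y \<Longrightarrow> isomorphic C Y X"
  unfolding isomorphic_def using is_isoE by metis

lemma isomorphic_trans: "isomorphic C X Y \<Longrightarrow> isomorphic C Y Z \<Longrightarrow> isomorphic C X Z"
  unfolding isomorphic_def using is_iso_comp by metis

lemma iso_class_eq: "isomorphic C X Y \<Longrightarrow> iso_class C X = iso_class C Y"
  unfolding iso_class_def using isomorphic_sym isomorphic_trans by blast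

lemma kernel_factor:
  assumes "is_kernel C X i Y p Z" "X \<in> Ob C" "arrow f T Y" "p \<cdot> f = zero_mor C T Z"
  obtains g where "arrow g T X" "i \<cdot> g = f"
  using assms unfolding is_kernel_def arr_def by metis

lemma kernel_cancel:
  assumes k: "is_kernel C X i Y p Z" and i: "arrow i X Y" and p: "arrow p Y Z"
    and g: "arrow g T X" and h: "arrow h T X" and "i \<cdot> g = i \<cdot> h"
  shows "g = h"
proof -
  have "p \<cdot> (i \<cdot> g) = zero_mor C T Z"
    using assoc[OF g i p] k zero_comp[OF g arr_ob(2)[OF p]] by (simp add: is_kernel_def)
  then show ?thesis
    using assms arr_comp[OF g i] unfolding is_kernel_def arr_def by metis
qed

lemma kernelI:
  assumes "X \<in> Ob C" "p \<cdot> i = zero_mor C X Z"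
    and "\<And>T f. arrow f T Y \<Longrightarrow> p \<cdot> f = zero_mor C T Z \<Longrightarrow> \<exists>g. arrow g T X \<and> i \<cdot> g = f"
    and "\<And>T g h. arrow g T X \<Longrightarrow> arrow h T X \<Longrightarrow> i \<cdot> g = i \<cdot> h \<Longrightarrow> g = h"
    and "Y \<in> Ob C"
  shows "is_kernel C X i Y p Z"
  unfolding is_kernel_def
proof (intro conjI ballI impI)
  fix T f assume "T \<in> Ob C" "f \<in> Mor C T Y" "p \<cdot> f = zero_mor C T Z"
  then show "\<exists>!g. g \<in> Mor C T X \<and> i \<cdot> g = f"
    using assms(1,5) assms(3,4)[unfolded arr_def] by metis
qed fact

lemma kernel_unique:
  assumes k: "is_kernel C N i X p M" and k': "is_kernel C N' i' X p M"
    and i: "arrow i N X" and i': "arrow i' N' X" and p: "arrow p X M"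
  obtains u where "is_iso C N N' u" "i' \<cdot> u = i"
proof -
  have pi: "p \<cdot> i = zero_mor C N M" "p \<cdot> i' = zero_mor C N' M" using k k' by (simp_all add: is_kernel_def)
  obtain u where u: "arrow u N N'" "i' \<cdot> u = i"
    using kernel_factor[OF k' arr_ob(1)[OF i'] i pi(1)] by metis
  obtain v where v: "arrow v N' N" "i \<cdot> v = i'"
    using kernel_factor[OF k arr_ob(1)[OF i] i' pi(2)] by metis
  have "i \<cdot> (v \<cdot> u) = i \<cdot> Idn C N"
    using assoc[OF u(1) v(1) i] u v id_r[OF i] by simp
  then have 1: "v \<cdot> u = Idn C N"
    using kernel_cancel[OF k i p] arr_comp u v arr_id arr_ob(1)[OF i] by blast
  have "i' \<cdot> (u \<cdot> v) = i' \<cdot> Idn C N'"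
    using assoc[OF v(1) u(1) i'] u v id_r[OF i'] by simp
  then have 2: "u \<cdot> v = Idn C N'"
    using kernel_cancel[OF k' i' p] arr_comp u v arr_id arr_ob(1)[OF i'] by blast
  show thesis using that is_isoI[OF u(1) v(1) 1 2] u(2) by blast
qed

lemma pullback_arr:
  assumes "pullback C Y p Z f Z' p' Y' f'"
  shows "arrow p Y Z" "arrow f Z' Z" "arrow p' Y' Z'" "arrow f' Y' Y" "p \<cdot> f' = f \<cdot> p'"
  using assms by (auto simp: pullback_def arr_def)

lemma pullback_factor:
  assumes "pullback C Y p Z f Z' p' Y' f'" "arrow u T Y" "arrow v T Z'" "p \<cdot> u = f \<cdot> v"
  obtains t where "arrow t T Y'" "f' \<cdot> t = u" "p' \<cdot> t = v"
  using assms unfolding pullback_def arr_def by metis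

lemma pullback_cancel:
  assumes pb: "pullback C Y p Z f Z' p' Y' f'" and s: "arrow s T Y'" and t: "arrow t T Y'"
    and "f' \<cdot> s = f' \<cdot> t" "p' \<cdot> s = p' \<cdot> t"
  shows "s = t"
proof -
  note a = pullback_arr[OF pb]
  have "p \<cdot> (f' \<cdot> s) = f \<cdot> (p' \<cdot> s)"
    using assoc[OF s a(4) a(1)] assoc[OF s a(3) a(2)] a(5) by simp
  then have "\<exists>!r. r \<in> Mor C T Y' \<and> f' \<cdot> r = f' \<cdot> s \<and> p' \<cdot> r = p' \<cdot> s"
    using pb arr_comp[OF s a(4)] arr_comp[OF s a(3)] unfolding pullback_def arr_def by simp
  then show ?thesis using assms unfolding arr_def by metis
qed

lemma pullbackI:
  assumes "arrow p Y Z" "arrow f Z' Z" "arrow p' Y' Z'" "arrow f' Y' Y" "p \<cdot> f' = f \<cdot> p'"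
    and ex: "\<And>T u v. arrow u T Y \<Longrightarrow> arrow v T Z' \<Longrightarrow> p \<cdot> u = f \<cdot> v
      \<Longrightarrow> \<exists>t. arrow t T Y' \<and> f' \<cdot> t = u \<and> p' \<cdot> t = v"
    and uni: "\<And>T s t. arrow s T Y' \<Longrightarrow> arrow t T Y' \<Longrightarrow> f' \<cdot> s = f' \<cdot> t \<Longrightarrow> p' \<cdot> s = p' \<cdot> t \<Longrightarrow> s = t"
  shows "pullback C Y p Z f Z' p' Y' f'"
proof -
  have "\<exists>!t. t \<in> Mor C T Y' \<and> f' \<cdot> t = u \<and> p' \<cdot> t = v"
    if "T \<in> Ob C" "u \<in> Mor C T Y" "v \<in> Mor C T Z'" "p \<cdot> u = f \<cdot> v" for T u v
  proof -
    have "arrow u T Y" "arrow v T Z'" using that assms by (auto simp: arr_def)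
    then obtain t where t: "arrow t T Y'" "f' \<cdot> t = u" "p' \<cdot> t = v" using ex \<open>p \<cdot> u = f \<cdot> v\<close> by blast
    show ?thesis
    proof (rule ex1I[of _ t])
      show "t \<in> Mor C T Y' \<and> f' \<cdot> t = u \<and> p' \<cdot> t = v" using t by (simp add: arr_def)
    next
      fix s assume "s \<in> Mor C T Y' \<and> f' \<cdot> s = u \<and> p' \<cdot> s = v"
      then show "s = t" using uni[of s T t] t by (simp add: arr_def)
    qed
  qed
  then show ?thesis using assms(1-5) unfolding pullback_def arr_def by blast
qed

lemma pullback_unique:
  assumes pb: "pullback C Y p Z f Z' p' Y' f'" and pb': "pullback C Y p Z f Z' p'' Y'' f''"
  obtains u where "is_iso C Y'' Y' u" "p' \<cdot> u = p''"
proof -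
  note a = pullback_arr[OF pb] and b = pullback_arr[OF pb']
  obtain u where u: "arrow u Y'' Y'" "f' \<cdot> u = f''" "p' \<cdot> u = p''"
    using pullback_factor[OF pb b(4) b(3) b(5)] by metis
  obtain v where v: "arrow v Y' Y''" "f'' \<cdot> v = f'" "p'' \<cdot> v = p'"
    using pullback_factor[OF pb' a(4) a(3) a(5)] by metis
  have "f' \<cdot> (u \<cdot> v) = f' \<cdot> Idn C Y'" "p' \<cdot> (u \<cdot> v) = p' \<cdot> Idn C Y'"
    using assoc[OF v(1) u(1) a(4)] assoc[OF v(1) u(1) a(3)] u v id_r[OF a(4)] id_r[OF a(3)] by simp_all
  then have 1: "u \<cdot> v = Idn C Y'"
    using pullback_cancel[OF pb] arr_comp[OF v(1) u(1)] arr_id arr_ob(1)[OF a(3)] by blast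
  have "f'' \<cdot> (v \<cdot> u) = f'' \<cdot> Idn C Y''" "p'' \<cdot> (v \<cdot> u) = p'' \<cdot> Idn C Y''"
    using assoc[OF u(1) v(1) b(4)] assoc[OF u(1) v(1) b(3)] u v id_r[OF b(4)] id_r[OF b(3)] by simp_all
  then have 2: "v \<cdot> u = Idn C Y''"
    using pullback_cancel[OF pb'] arr_comp[OF u(1) v(1)] arr_id arr_ob(1)[OF b(3)] by blast
  show thesis using that is_isoI[OF u(1) v(1) 2 1] u(3) by blast
qed

text \<open>A morphism into \<open>Y\<close> killed by \<open>p\<close> and the zero morphism into \<open>Z'\<close> agree over \<open>Z\<close>, so such a
  morphism factors uniquely through the pullback and there through the kernel of \<open>p'\<close>. Thus an
  extension and its pullback have the same kernel object.\<close>

lemma kernel_of_pullback: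
  assumes pb: "pullback C Y p Z f Z' p' Y' f'" and k: "is_kernel C N i Y' p' Z'" and i: "arrow i N Y'"
  shows "is_kernel C N (f' \<cdot> i) Y p Z"
proof (rule kernelI)
  note a = pullback_arr[OF pb]
  show "N \<in> Ob C" "Y \<in> Ob C" using i a by (auto simp: arr_def)
  have pi: "p' \<cdot> i = zero_mor C N Z'" using k by (simp add: is_kernel_def)
  show "p \<cdot> (f' \<cdot> i) = zero_mor C N Z"
    using assoc[OF i a(4) a(1)] assoc[OF i a(3) a(2)] a(5) pi comp_zero[OF a(2)] i by (simp add: arr_def)
  fix T
  {
    fix g assume g: "arrow g T Y" "p \<cdot> g = zero_mor C T Z"
    have T: "T \<in> Ob C" "Z' \<in> Ob C" using g a by (auto simp: arr_def)
    have "p \<cdot> g = f \<cdot> zero_mor C T Z'" using g(2) comp_zero[OF a(2) T(1)] by simp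
    then obtain t where t: "arrow t T Y'" "f' \<cdot> t = g" "p' \<cdot> t = zero_mor C T Z'"
      using pullback_factor[OF pb g(1) arr_zero[OF T]] by metis
    then obtain s where s: "arrow s T N" "i \<cdot> s = t" using kernel_factor[OF k] i arr_ob by metis
    then show "\<exists>h. arrow h T N \<and> (f' \<cdot> i) \<cdot> h = g" using assoc[OF s(1) i a(4)] t by auto
  }
  fix g h assume gh: "arrow g T N" "arrow h T N" "(f' \<cdot> i) \<cdot> g = (f' \<cdot> i) \<cdot> h"
  have T: "Z' \<in> Ob C" using a by (auto simp: arr_def)
  have "f' \<cdot> (i \<cdot> g) = f' \<cdot> (i \<cdot> h)" using gh(3) assoc[OF gh(1) i a(4)] assoc[OF gh(2) i a(4)] by simp
  moreover have "p' \<cdot> (i \<cdot> g) = p' \<cdot> (i \<cdot> h)"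
    using assoc[OF gh(1) i a(3)] assoc[OF gh(2) i a(3)] pi zero_comp[OF gh(1) T] zero_comp[OF gh(2) T] by simp
  ultimately have "i \<cdot> g = i \<cdot> h"
    using pullback_cancel[OF pb arr_comp[OF gh(1) i] arr_comp[OF gh(2) i]] by blast
  then show "g = h" using kernel_cancel[OF k i a(3) gh(1,2)] by blast
qed

text \<open>The composite \<open>q \<cdot> p\<close> kills a morphism exactly if \<open>p\<close> carries it into the kernel of \<open>q\<close>, which is
  the condition for factoring through the pullback.\<close>

lemma pullback_of_kernel:
  assumes pb: "pullback C Y p Z j B p' D f'" and k: "is_kernel C B j Z q W" and q: "arrow q Z W"
  shows "is_kernel C D f' Y (q \<cdot> p) W"
proof (rule kernelI)
  note a = pullback_arr[OF pb]
  have W: "W \<in> Ob C" and B: "B \<in> Ob C" using q a by (auto simp: arr_def)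
  have qj: "q \<cdot> j = zero_mor C B W" using k by (simp add: is_kernel_def)
  show "D \<in> Ob C" "Y \<in> Ob C" using a by (auto simp: arr_def)
  show "q \<cdot> p \<cdot> f' = zero_mor C D W"
    using assoc[OF a(4) a(1) q] assoc[OF a(3) a(2) q] a(5) qj zero_comp[OF a(3) W] by simp
  fix T
  {
    fix g assume g: "arrow g T Y" "q \<cdot> p \<cdot> g = zero_mor C T W"
    then have "q \<cdot> (p \<cdot> g) = zero_mor C T W" using assoc[OF g(1) a(1) q] by simp
    then obtain s where s: "arrow s T B" "j \<cdot> s = p \<cdot> g"
      using kernel_factor[OF k B arr_comp[OF g(1) a(1)]] by metis
    then show "\<exists>h. arrow h T D \<and> f' \<cdot> h = g"
      using pullback_factor[OF pb g(1) s(1)] by metis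
  }
  fix g h assume gh: "arrow g T D" "arrow h T D" "f' \<cdot> g = f' \<cdot> h"
  have "j \<cdot> (p' \<cdot> g) = j \<cdot> (p' \<cdot> h)"
    using assoc[OF gh(1) a(3) a(2)] assoc[OF gh(2) a(3) a(2)] assoc[OF gh(1) a(4) a(1)]
      assoc[OF gh(2) a(4) a(1)] a(5) gh(3) by simp
  then have "p' \<cdot> g = p' \<cdot> h"
    using kernel_cancel[OF k a(2) q arr_comp[OF gh(1) a(3)] arr_comp[OF gh(2) a(3)]] by blast
  then show "g = h" using pullback_cancel[OF pb gh(1,2,3)] by blast
qed

lemma biproduct_arr:
  assumes "biproduct C M N S i1 i2 p1 p2"
  shows "arrow i1 M S" "arrow i2 N S" "arrow p1 S M" "arrow p2 S N"
  using assms by (auto simp: biproduct_def arr_def)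

lemma biproduct_factor:
  assumes bp: "biproduct C M N S i1 i2 p1 p2" and u: "arrow u T M" and v: "arrow v T N"
  obtains t where "arrow t T S" "p1 \<cdot> t = u" "p2 \<cdot> t = v"
proof
  note a = biproduct_arr[OF bp]
  have T: "T \<in> Ob C" "M \<in> Ob C" "N \<in> Ob C" using u v by (auto simp: arr_def)
  interpret TM: abelian_group "HomSp C T M" using abelian_group_hom T by blast
  interpret TN: abelian_group "HomSp C T N" using abelian_group_hom T by blast
  note iu = arr_comp[OF u a(1)] and iv = arr_comp[OF v a(2)]
  let ?t = "(i1 \<cdot> u) \<oplus>\<^bsub>HomSp C T S\<^esub> (i2 \<cdot> v)"
  have e: "p1 \<cdot> i1 = Idn C M" "p2 \<cdot> i2 = Idn C N" "p1 \<cdot> i2 = zero_mor C N M" "p2 \<cdot> i1 = zero_mor C M N"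
    using bp by (auto simp: biproduct_def)
  show "arrow ?t T S" by (rule arr_add[OF iu iv])
  have "p1 \<cdot> ?t = ((p1 \<cdot> i1) \<cdot> u) \<oplus>\<^bsub>HomSp C T M\<^esub> ((p1 \<cdot> i2) \<cdot> v)"
    using comp_add[OF iu iv a(3)] assoc[OF u a(1) a(3)] assoc[OF v a(2) a(3)] by simp
  then show "p1 \<cdot> ?t = u"
    using e id_l[OF u] zero_comp[OF v] T u by (simp add: arr_def)
  have "p2 \<cdot> ?t = ((p2 \<cdot> i1) \<cdot> u) \<oplus>\<^bsub>HomSp C T N\<^esub> ((p2 \<cdot> i2) \<cdot> v)"
    using comp_add[OF iu iv a(4)] assoc[OF u a(1) a(4)] assoc[OF v a(2) a(4)] by simp
  then show "p2 \<cdot> ?t = v"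
    using e id_l[OF v] zero_comp[OF u] T v by (simp add: arr_def)
qed

lemma biproduct_cancel:
  assumes bp: "biproduct C M N S i1 i2 p1 p2" and s: "arrow s T S" and t: "arrow t T S"
    and e: "p1 \<cdot> s = p1 \<cdot> t" "p2 \<cdot> s = p2 \<cdot> t"
  shows "s = t"
proof -
  note a = biproduct_arr[OF bp]
  have "r = (i1 \<cdot> (p1 \<cdot> r)) \<oplus>\<^bsub>HomSp C T S\<^esub> (i2 \<cdot> (p2 \<cdot> r))" if r: "arrow r T S" for r
  proof -
    have "r = Idn C S \<cdot> r" using id_l[OF r] by simp
    also have "\<dots> = ((i1 \<cdot> p1) \<oplus>\<^bsub>HomSp C S S\<^esub> (i2 \<cdot> p2)) \<cdot> r" using bp by (simp add: biproduct_def)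
    also have "\<dots> = ((i1 \<cdot> p1) \<cdot> r) \<oplus>\<^bsub>HomSp C T S\<^esub> ((i2 \<cdot> p2) \<cdot> r)"
      using add_comp[OF r arr_comp[OF a(3) a(1)] arr_comp[OF a(4) a(2)]] .
    finally show ?thesis using assoc[OF r a(3) a(1)] assoc[OF r a(4) a(2)] by simp
  qed
  from this[OF s] this[OF t] e show ?thesis by simp
qed

lemma biproduct_swap:
  assumes bp: "biproduct C M N S i1 i2 p1 p2"
  shows "biproduct C N M S i2 i1 p2 p1"
proof -
  note a = biproduct_arr[OF bp]
  have S: "S \<in> Ob C" using a by (simp add: arr_def)
  interpret SS: abelian_group "HomSp C S S" using abelian_group_hom S by blast
  have "(i1 \<cdot> p1) \<in> Mor C S S" "(i2 \<cdot> p2) \<in> Mor C S S"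
    using arr_comp[OF a(3) a(1)] arr_comp[OF a(4) a(2)] by (simp_all add: arr_def)
  then show ?thesis using bp SS.a_comm unfolding biproduct_def by auto
qed

lemma direct_sum_commute: "direct_sum C M N S \<longleftrightarrow> direct_sum C N M S"
  unfolding direct_sum_def using biproduct_swap by blast

lemma biproduct_kernel:
  assumes bp: "biproduct C M N S i1 i2 p1 p2"
  shows "is_kernel C M i1 S p2 N"
proof (rule kernelI)
  note a = biproduct_arr[OF bp]
  have T: "M \<in> Ob C" "N \<in> Ob C" "S \<in> Ob C" using a by (auto simp: arr_def)
  show "M \<in> Ob C" "S \<in> Ob C" by fact+
  have e: "p1 \<cdot> i1 = Idn C M" "p2 \<cdot> i1 = zero_mor C M N"
    using bp by (auto simp: biproduct_def)
  then show "p2 \<cdot> i1 = zero_mor C M N" by simp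
  fix T
  {
    fix f assume f: "arrow f T S" "p2 \<cdot> f = zero_mor C T N"
    note u = arr_comp[OF f(1) a(3)]
    have "i1 \<cdot> (p1 \<cdot> f) = f"
    proof (rule biproduct_cancel[OF bp arr_comp[OF u a(1)] f(1)])
      show "p1 \<cdot> (i1 \<cdot> (p1 \<cdot> f)) = p1 \<cdot> f"
        using assoc[OF u a(1) a(3)] e id_l[OF u] by simp
      show "p2 \<cdot> (i1 \<cdot> (p1 \<cdot> f)) = p2 \<cdot> f"
        using assoc[OF u a(1) a(4)] e zero_comp[OF u T(2)] f(2) by simp
    qed
    then show "\<exists>g. arrow g T M \<and> i1 \<cdot> g = f" using u by blast
  }
  fix g h assume gh: "arrow g T M" "arrow h T M" "i1 \<cdot> g = i1 \<cdot> h"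
  then show "g = h"
    using assoc[OF gh(1) a(1) a(3)] assoc[OF gh(2) a(1) a(3)] e id_l[OF gh(1)] id_l[OF gh(2)] by simp
qed

text \<open>A morphism into \<open>Y \<oplus> Z'\<close> is killed by \<open>p b\<^sub>1 - f b\<^sub>2\<close> exactly if its components agree over \<open>Z\<close>.\<close>

lemma pullback_kernel_of_difference:
  assumes pb: "arrow p Y Z" "arrow f Z' Z" and bp: "biproduct C Y Z' S a1 a2 b1 b2"
    and k: "is_kernel C L l S ((p \<cdot> b1) \<ominus>\<^bsub>HomSp C S Z\<^esub> (f \<cdot> b2)) Z" and l: "arrow l L S"
  shows "pullback C Y p Z f Z' (b2 \<cdot> l) L (b1 \<cdot> l)"
proof -
  note a = biproduct_arr[OF bp]
  note pb1 = arr_comp[OF a(3) pb(1)] and fb2 = arr_comp[OF a(4) pb(2)]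
  have Z: "Z \<in> Ob C" and L: "L \<in> Ob C" using pb l by (auto simp: arr_def)
  let ?g = "(p \<cdot> b1) \<ominus>\<^bsub>HomSp C S Z\<^esub> (f \<cdot> b2)"
  note g = arr_diff[OF pb1 fb2]
  have zero: "?g \<cdot> t = zero_mor C T Z \<longleftrightarrow> p \<cdot> (b1 \<cdot> t) = f \<cdot> (b2 \<cdot> t)" if t: "arrow t T S" for t T
    using diff_comp[OF t pb1 fb2] diff_zero_iff[OF arr_comp[OF t pb1] arr_comp[OF t fb2]]
      assoc[OF t a(3) pb(1)] assoc[OF t a(4) pb(2)] by simp
  show ?thesis
  proof (rule pullbackI)
    show "arrow p Y Z" "arrow f Z' Z" by fact+
    show "arrow (b2 \<cdot> l) L Z'" "arrow (b1 \<cdot> l) L Y" using arr_comp[OF l a(3)] arr_comp[OF l a(4)] by auto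
    show "p \<cdot> (b1 \<cdot> l) = f \<cdot> (b2 \<cdot> l)" using zero[OF l] k by (simp add: is_kernel_def)
    fix T
    {
      fix u v assume u: "arrow u T Y" and v: "arrow v T Z'" and e: "p \<cdot> u = f \<cdot> v"
      obtain t where t: "arrow t T S" "b1 \<cdot> t = u" "b2 \<cdot> t = v" using biproduct_factor[OF bp u v] .
      then have "?g \<cdot> t = zero_mor C T Z" using zero[OF t(1)] e by simp
      then obtain s where s: "arrow s T L" "l \<cdot> s = t" using kernel_factor[OF k L t(1)] by metis
      then show "\<exists>s. arrow s T L \<and> (b1 \<cdot> l) \<cdot> s = u \<and> (b2 \<cdot> l) \<cdot> s = v"
        using assoc[OF s(1) l a(3)] assoc[OF s(1) l a(4)] t by auto
    }
    fix s t assume st: "arrow s T L" "arrow t T L" "(b1 \<cdot> l) \<cdot> s = (b1 \<cdot> l) \<cdot> t" "(b2 \<cdot> l) \<cdot> s = (b2 \<cdot> l) \<cdot> t"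
    have "l \<cdot> s = l \<cdot> t"
      using biproduct_cancel[OF bp arr_comp[OF st(1) l] arr_comp[OF st(2) l]] st(3,4)
        assoc[OF st(1) l a(3)] assoc[OF st(1) l a(4)] assoc[OF st(2) l a(3)] assoc[OF st(2) l a(4)] by simp
    then show "s = t" using kernel_cancel[OF k l g st(1,2)] by blast
  qed
qed

text \<open>The inverses are explicit because passing to the opposite category exchanges them with the given
  isomorphisms.\<close>

lemma kernel_transport:
  assumes k: "is_kernel C X i Y p Z"
    and i: "arrow i X Y" and p: "arrow p Y Z" and i': "arrow i' X' Y'" and p': "arrow p' Y' Z'"
    and a: "arrow a X X'" "arrow a' X' X" "a \<cdot> a' = Idn C X'" "a' \<cdot> a = Idn C X"
    and b: "arrow b Y Y'" "arrow b' Y' Y" "b \<cdot> b' = Idn C Y'" "b' \<cdot> b = Idn C Y"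
    and c: "arrow c Z Z'" "arrow c' Z' Z" "c \<cdot> c' = Idn C Z'" "c' \<cdot> c = Idn C Z"
    and e: "b \<cdot> i = i' \<cdot> a" "c \<cdot> p = p' \<cdot> b"
  shows "is_kernel C X' i' Y' p' Z'"
proof (rule kernelI)
  have T: "X' \<in> Ob C" "Y' \<in> Ob C" "Z' \<in> Ob C" "X \<in> Ob C" using i' p' i by (auto simp: arr_def)
  show "X' \<in> Ob C" "Y' \<in> Ob C" by fact+
  have i'e: "i' = b \<cdot> (i \<cdot> a')"
    using assoc[OF a(2) i b(1)] e(1) assoc[OF a(2) a(1) i'] a(3) id_r[OF i'] by simp
  have "p' \<cdot> i' = (p' \<cdot> b) \<cdot> (i \<cdot> a')" using i'e assoc[OF arr_comp[OF a(2) i] b(1) p'] by simp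
  also have "\<dots> = c \<cdot> ((p \<cdot> i) \<cdot> a')"
    using e(2) assoc[OF arr_comp[OF a(2) i] p c(1)] assoc[OF a(2) i p] by simp
  also have "\<dots> = zero_mor C X' Z'"
    using k zero_comp[OF a(2)] comp_zero[OF c(1)] T c by (simp add: is_kernel_def arr_def)
  finally show "p' \<cdot> i' = zero_mor C X' Z'" .
  have e': "p \<cdot> b' = c' \<cdot> p'"
  proof -
    have "p \<cdot> b' = (c' \<cdot> (c \<cdot> p)) \<cdot> b'" using assoc[OF p c(1) c(2)] c(4) id_l[OF p] by simp
    also have "\<dots> = c' \<cdot> (p' \<cdot> (b \<cdot> b'))"
      using e(2) assoc[OF b(2) arr_comp[OF b(1) p'] c(2)] assoc[OF b(2) b(1) p'] by simp
    finally show ?thesis using b(3) id_r[OF p'] by simp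
  qed
  fix T
  {
    fix f assume f: "arrow f T Y'" "p' \<cdot> f = zero_mor C T Z'"
    note bf = arr_comp[OF f(1) b(2)]
    have "p \<cdot> (b' \<cdot> f) = c' \<cdot> (p' \<cdot> f)" using assoc[OF f(1) b(2) p] e' assoc[OF f(1) p' c(2)] by simp
    then have "p \<cdot> (b' \<cdot> f) = zero_mor C T Z" using f(2) comp_zero[OF c(2)] f(1) by (simp add: arr_def)
    then obtain g where g: "arrow g T X" "i \<cdot> g = b' \<cdot> f" using kernel_factor[OF k T(4) bf] by metis
    have "i' \<cdot> (a \<cdot> g) = b \<cdot> (b' \<cdot> f)"
      using assoc[OF g(1) a(1) i'] e(1) assoc[OF g(1) i b(1)] g(2) by simp
    also have "\<dots> = f" using assoc[OF f(1) b(2) b(1)] b(3) id_l[OF f(1)] by simp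
    finally show "\<exists>g. arrow g T X' \<and> i' \<cdot> g = f" using arr_comp[OF g(1) a(1)] by blast
  }
  fix g h assume gh: "arrow g T X'" "arrow h T X'" "i' \<cdot> g = i' \<cdot> h"
  have "i \<cdot> (a' \<cdot> t) = b' \<cdot> (i' \<cdot> t)" if t: "arrow t T X'" for t
  proof -
    note at = arr_comp[OF t a(2)]
    have "i' \<cdot> t = b \<cdot> (i \<cdot> (a' \<cdot> t))"
      using i'e assoc[OF t arr_comp[OF a(2) i] b(1)] assoc[OF t a(2) i] by simp
    then show ?thesis using assoc[OF arr_comp[OF at i] b(1) b(2)] b(4) id_l[OF arr_comp[OF at i]] by simp
  qed
  then have "i \<cdot> (a' \<cdot> g) = i \<cdot> (a' \<cdot> h)" using gh by simp
  then have "a' \<cdot> g = a' \<cdot> h"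
    using kernel_cancel[OF k i p arr_comp[OF gh(1) a(2)] arr_comp[OF gh(2) a(2)]] by blast
  then have "a \<cdot> (a' \<cdot> g) = a \<cdot> (a' \<cdot> h)" by simp
  then show "g = h"
    using assoc[OF gh(1) a(2) a(1)] assoc[OF gh(2) a(2) a(1)] a(3) id_l[OF gh(1)] id_l[OF gh(2)] by simp
qed

end

section \<open>The opposite category\<close>

definition opposite :: "('o, 'm, 'k) lin_cat \<Rightarrow> ('o, 'm, 'k) lin_cat" where
  "opposite C = \<lparr>Ob = Ob C, HomSp = (\<lambda>A B. HomSp C B A), Comp = (\<lambda>g f. f \<star>\<^bsub>C\<^esub> g), Idn = Idn C\<rparr>"

text \<open>The dual of \<open>X \<rightarrow> Y \<rightarrow> Z\<close> is \<open>Z \<rightarrow> Y \<rightarrow> X\<close>, so inflations and deflations trade places.\<close>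

definition opposite_seqs :: "('o, 'm) seq set \<Rightarrow> ('o, 'm) seq set" where
  "opposite_seqs E = {(Z, p, Y, i, X) | X i Y p Z. (X, i, Y, p, Z) \<in> E}"

lemma opposite_simps [simp]:
  "Ob (opposite C) = Ob C" "HomSp (opposite C) A B = HomSp C B A"
  "Comp (opposite C) g f = f \<star>\<^bsub>C\<^esub> g" "Idn (opposite C) = Idn C"
  by (simp_all add: opposite_def)

lemma mem_opposite_seqs [simp]: "(Z, p, Y, i, X) \<in> opposite_seqs E \<longleftrightarrow> (X, i, Y, p, Z) \<in> E"
  by (simp add: opposite_seqs_def)

lemma arr_opposite [simp]: "arr (opposite C) f X Y \<longleftrightarrow> arr C f Y X"
  by (auto simp: arr_def)

lemma is_iso_opposite [simp]: "is_iso (opposite C) A B f \<longleftrightarrow> is_iso C B A f"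
  by (auto simp: is_iso_def)

lemma kernel_opposite [simp]: "is_kernel (opposite C) Z p Y i X \<longleftrightarrow> is_cokernel C X i Y p Z"
  by (simp add: is_kernel_def is_cokernel_def)

lemma cokernel_opposite [simp]: "is_cokernel (opposite C) Z p Y i X \<longleftrightarrow> is_kernel C X i Y p Z"
  by (simp add: is_kernel_def is_cokernel_def)

lemma pairs_opposite: "kernel_cokernel_pairs (opposite C) = opposite_seqs (kernel_cokernel_pairs C)"
  by (auto simp: kernel_cokernel_pairs_def opposite_seqs_def)

lemma admissible_mono_opposite [simp]: "admissible_mono (opposite_seqs E) X i Y \<longleftrightarrow> admissible_epi E Y i X"
  unfolding admissible_mono_def admissible_epi_def mem_opposite_seqs by blast

lemma admissible_epi_opposite [simp]: "admissible_epi (opposite_seqs E) Y p Z \<longleftrightarrow> admissible_mono E Z p Y"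
  unfolding admissible_mono_def admissible_epi_def mem_opposite_seqs by blast

lemma pushout_opposite [simp]: "pushout (opposite C) Z p Y f Z' p' Y' f' \<longleftrightarrow> pullback C Y p Z f Z' p' Y' f'"
  by (auto simp: pushout_def pullback_def)

lemma pullback_opposite [simp]: "pullback (opposite C) Y i X f X' i' Y' f' \<longleftrightarrow> pushout C X i Y f X' i' Y' f'"
  by (auto simp: pushout_def pullback_def)

lemma zero_object_opposite [simp]: "zero_object (opposite C) Z \<longleftrightarrow> zero_object C Z"
  by (auto simp: zero_object_def)

lemma biproduct_opposite [simp]:
  "biproduct (opposite C) M N S i1 i2 p1 p2 \<longleftrightarrow> biproduct C M N S p1 p2 i1 i2"
  by (auto simp: biproduct_def)

lemma direct_sum_opposite [simp]: "direct_sum (opposite C) M N S \<longleftrightarrow> direct_sum C M N S"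
  by (auto simp: direct_sum_def)

context linear_category
begin

lemma linear_category_opposite: "linear_category K (opposite C)"
proof (rule linear_category.intro)
  show "field K" by (rule field_K)
qed (use hom_space id_in comp_in comp_assoc[symmetric] id_left id_right comp_add_left comp_add_right
    comp_smult_left comp_smult_right in \<open>simp_all only: opposite_simps\<close>)

lemma isomorphic_opposite: "isomorphic (opposite C) X Y \<longleftrightarrow> isomorphic C X Y"
  using isomorphic_sym[of X Y] isomorphic_sym[of Y X] by (auto simp: isomorphic_def)

lemma iso_class_opposite: "iso_class (opposite C) X = iso_class C X"
  by (simp add: iso_class_def isomorphic_opposite)

text \<open>The cokernel half is the kernel half in the opposite category, where the isomorphisms of the
  sequences are replaced by their inverses.\<close>

lemma pairs_transport:
  assumes s: "(X, i, Y, p, Z) \<in> kernel_cokernel_pairs C" and i': "arrow i' X' Y'" and p': "arrow p' Y' Z'"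
    and a: "is_iso C X X' a" and b: "is_iso C Y Y' b" and c: "is_iso C Z Z' c"
    and e: "b \<cdot> i = i' \<cdot> a" "c \<cdot> p = p' \<cdot> b"
  shows "(X', i', Y', p', Z') \<in> kernel_cokernel_pairs C"
proof -
  interpret op: linear_category K "opposite C" by (rule linear_category_opposite)
  have i: "arrow i X Y" and p: "arrow p Y Z" and k: "is_kernel C X i Y p Z" and ck: "is_cokernel C X i Y p Z"
    using s by (auto simp: kernel_cokernel_pairs_def arr_def)
  have T: "X \<in> Ob C" "Y \<in> Ob C" "Z \<in> Ob C" "X' \<in> Ob C" "Y' \<in> Ob C" "Z' \<in> Ob C"
    using i p i' p' by (auto simp: arr_def)
  obtain a' where a: "arrow a X X'" "arrow a' X' X" "a' \<cdot> a = Idn C X" "a \<cdot> a' = Idn C X'"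
    using is_isoE[OF a] T by metis
  obtain b' where b: "arrow b Y Y'" "arrow b' Y' Y" "b' \<cdot> b = Idn C Y" "b \<cdot> b' = Idn C Y'"
    using is_isoE[OF b] T by metis
  obtain c' where c: "arrow c Z Z'" "arrow c' Z' Z" "c' \<cdot> c = Idn C Z" "c \<cdot> c' = Idn C Z'"
    using is_isoE[OF c] T by metis
  have "i \<cdot> a' = (b' \<cdot> (b \<cdot> i)) \<cdot> a'" using assoc[OF i b(1) b(2)] b id_l[OF i] by simp
  also have "\<dots> = b' \<cdot> (i' \<cdot> (a \<cdot> a'))"
    using e assoc[OF a(2) arr_comp[OF a(1) i'] b(2)] assoc[OF a(2) a(1) i'] by simp
  finally have e1: "i \<cdot> a' = b' \<cdot> i'" using a id_r[OF i'] by simp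
  have "p \<cdot> b' = (c' \<cdot> (c \<cdot> p)) \<cdot> b'" using assoc[OF p c(1) c(2)] c id_l[OF p] by simp
  also have "\<dots> = c' \<cdot> (p' \<cdot> (b \<cdot> b'))"
    using e assoc[OF b(2) arr_comp[OF b(1) p'] c(2)] assoc[OF b(2) b(1) p'] by simp
  finally have e2: "p \<cdot> b' = c' \<cdot> p'" using b id_r[OF p'] by simp
  have "is_kernel C X' i' Y' p' Z'"
    using kernel_transport[OF k i p i' p' a(1,2,4,3) b(1,2,4,3) c(1,2,4,3) e] .
  moreover have "is_cokernel C X' i' Y' p' Z'"
    using op.kernel_transport[of Z p Y i X p' Z' Y' i' X' c' c b' b a' a] ck i p i' p' a b c e1 e2 by simp
  ultimately show ?thesis using i' p' by (auto simp: kernel_cokernel_pairs_def arr_def)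
qed

lemma seq_iso_sym:
  assumes "seq_iso C s t" "s \<in> kernel_cokernel_pairs C" "t \<in> kernel_cokernel_pairs C"
  shows "seq_iso C t s"
proof -
  obtain X i Y p Z where s: "s = (X, i, Y, p, Z)" by (metis prod_cases5)
  obtain X' i' Y' p' Z' where t: "t = (X', i', Y', p', Z')" by (metis prod_cases5)
  have i: "arrow i X Y" "arrow p Y Z" and i': "arrow i' X' Y'" "arrow p' Y' Z'"
    using assms s t by (auto simp: kernel_cokernel_pairs_def arr_def)
  have T: "X \<in> Ob C" "Y \<in> Ob C" "Z \<in> Ob C" "X' \<in> Ob C" "Y' \<in> Ob C" "Z' \<in> Ob C"
    using i i' by (auto simp: arr_def)
  obtain a b c where abc: "is_iso C X X' a" "is_iso C Y Y' b" "is_iso C Z Z' c"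
    and e: "b \<cdot> i = i' \<cdot> a" "c \<cdot> p = p' \<cdot> b" using assms(1) s t by (auto simp: seq_iso_def)
  obtain a' where a: "arrow a X X'" "arrow a' X' X" "a' \<cdot> a = Idn C X" "a \<cdot> a' = Idn C X'" "is_iso C X' X a'"
    using is_isoE[OF abc(1)] T by metis
  obtain b' where b: "arrow b Y Y'" "arrow b' Y' Y" "b' \<cdot> b = Idn C Y" "b \<cdot> b' = Idn C Y'" "is_iso C Y' Y b'"
    using is_isoE[OF abc(2)] T by metis
  obtain c' where c: "arrow c Z Z'" "arrow c' Z' Z" "c' \<cdot> c = Idn C Z" "c \<cdot> c' = Idn C Z'" "is_iso C Z' Z c'"
    using is_isoE[OF abc(3)] T by metis
  have "i \<cdot> a' = (b' \<cdot> (b \<cdot> i)) \<cdot> a'" using assoc[OF i(1) b(1) b(2)] b id_l[OF i(1)] by simp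
  also have "\<dots> = b' \<cdot> (i' \<cdot> (a \<cdot> a'))"
    using e assoc[OF a(2) arr_comp[OF a(1) i'(1)] b(2)] assoc[OF a(2) a(1) i'(1)] by simp
  finally have e1: "i \<cdot> a' = b' \<cdot> i'" using a id_r[OF i'(1)] by simp
  have "p \<cdot> b' = (c' \<cdot> (c \<cdot> p)) \<cdot> b'" using assoc[OF i(2) c(1) c(2)] c id_l[OF i(2)] by simp
  also have "\<dots> = c' \<cdot> (p' \<cdot> (b \<cdot> b'))"
    using e assoc[OF b(2) arr_comp[OF b(1) i'(2)] c(2)] assoc[OF b(2) b(1) i'(2)] by simp
  finally have e2: "p \<cdot> b' = c' \<cdot> p'" using b id_r[OF i'(2)] by simp
  show ?thesis unfolding s t seq_iso_def prod.case using a(5) b(5) c(5) e1[symmetric] e2[symmetric] by blast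
qed

lemma seq_iso_opposite:
  "seq_iso (opposite C) (Z, p, Y, i, X) (Z', p', Y', i', X') \<longleftrightarrow> seq_iso C (X', i', Y', p', Z') (X, i, Y, p, Z)"
  unfolding seq_iso_def prod.case is_iso_opposite opposite_simps by (metis (no_types))

end

lemma (in linear_additive_category) linear_additive_category_opposite:
  "linear_additive_category K (opposite C)"
proof -
  interpret op: linear_category K "opposite C" by (rule linear_category_opposite)
  show ?thesis by unfold_locales (use ex_zero_object ex_direct_sum in simp_all)
qed

section \<open>Exact categories\<close>

locale exact_category = linear_additive_category K C
  for K :: "'k ring" and C :: "('o, 'm, 'k) lin_cat" +
  fixes E :: "('o, 'm) seq set"
  assumes exact: "exact_structure C E"
begin

lemma pairs: "E \<subseteq> kernel_cokernel_pairs C"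
  using exact by (simp add: exact_structure_def)

lemma exact_opposite: "exact_structure (opposite C) (opposite_seqs E)"
proof -
  have 1: "opposite_seqs E \<subseteq> kernel_cokernel_pairs (opposite C)"
    using pairs by (auto simp: pairs_opposite)
  have 2: "\<forall>s \<in> opposite_seqs E. \<forall>t \<in> kernel_cokernel_pairs (opposite C).
      seq_iso (opposite C) s t \<longrightarrow> t \<in> opposite_seqs E"
  proof (intro ballI impI)
    fix s t
    assume s: "s \<in> opposite_seqs E" and t: "t \<in> kernel_cokernel_pairs (opposite C)"
      and st: "seq_iso (opposite C) s t"
    obtain X i Y p Z where se: "s = (Z, p, Y, i, X)" by (metis prod_cases5)
    obtain X' i' Y' p' Z' where te: "t = (Z', p', Y', i', X')" by (metis prod_cases5)
    have "seq_iso C (X', i', Y', p', Z') (X, i, Y, p, Z)"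
      using st se te seq_iso_opposite by simp
    moreover have s': "(X, i, Y, p, Z) \<in> E" using s se by simp
    moreover have t': "(X', i', Y', p', Z') \<in> kernel_cokernel_pairs C" using t te by (simp add: pairs_opposite)
    ultimately have "seq_iso C (X, i, Y, p, Z) (X', i', Y', p', Z')" using seq_iso_sym pairs by blast
    then show "t \<in> opposite_seqs E" using s' t' te exact by (auto simp: exact_structure_def)
  qed
  show ?thesis
    unfolding exact_structure_def using 1 2 exact[unfolded exact_structure_def] by auto
qed

lemma exact_category_opposite: "exact_category K (opposite C) (opposite_seqs E)"
  using exact_opposite linear_additive_category_opposite
  by (simp add: exact_category_def exact_category_axioms_def)

lemma conflation:
  assumes "(X, i, Y, p, Z) \<in> E"
  shows "arrow i X Y" "arrow p Y Z" "is_kernel C X i Y p Z" "is_cokernel C X i Y p Z"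
  using assms pairs by (auto simp: kernel_cokernel_pairs_def arr_def)

lemma conflation_transport:
  assumes s: "(X, i, Y, p, Z) \<in> E" and "arrow i' X' Y'" "arrow p' Y' Z'"
    and "is_iso C X X' a" "is_iso C Y Y' b" "is_iso C Z Z' c"
    and "b \<cdot> i = i' \<cdot> a" "c \<cdot> p = p' \<cdot> b"
  shows "(X', i', Y', p', Z') \<in> E"
proof -
  have "(X', i', Y', p', Z') \<in> kernel_cokernel_pairs C" using pairs_transport assms pairs by blast
  moreover have "seq_iso C (X, i, Y, p, Z) (X', i', Y', p', Z')" using assms by (auto simp: seq_iso_def)
  ultimately show ?thesis using exact s by (auto simp: exact_structure_def)
qed

lemma conflation_change_kernel:
  assumes s: "(X, i, Y, p, Z) \<in> E" and k: "is_kernel C X' i' Y p Z" and i': "arrow i' X' Y"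
  shows "(X', i', Y, p, Z) \<in> E" "isomorphic C X' X"
proof -
  note c = conflation[OF s]
  have T: "X \<in> Ob C" "Y \<in> Ob C" "Z \<in> Ob C" "X' \<in> Ob C" using c i' by (auto simp: arr_def)
  obtain u where u: "is_iso C X X' u" "i' \<cdot> u = i" using kernel_unique[OF c(3) k c(1) i' c(2)] .
  show "(X', i', Y, p, Z) \<in> E"
    using conflation_transport[OF s i' c(2) u(1) is_iso_id[OF T(2)] is_iso_id[OF T(3)]] u(2)
      id_l[OF c(1)] id_l[OF c(2)] id_r[OF c(2)] by simp
  show "isomorphic C X' X" using u(1) T isomorphic_sym by (auto simp: isomorphic_def)
qed

text \<open>The axiom only provides some pullback that is a deflation. Pullbacks are unique up to
  isomorphism and conflations are closed under isomorphism, so every pullback is one.\<close>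

lemma deflation_pullback:
  assumes e: "admissible_epi E Y p Z" and pb: "pullback C Y p Z f Z' p' Y' f'"
  shows "admissible_epi E Y' p' Z'"
proof -
  note a = pullback_arr[OF pb]
  have "Z' \<in> Ob C" "f \<in> Mor C Z' Z" using a by (auto simp: arr_def)
  then obtain p'' Y'' f'' where pb': "pullback C Y p Z f Z' p'' Y'' f''" and e': "admissible_epi E Y'' p'' Z'"
    using exact e unfolding exact_structure_def by metis
  obtain N i where s: "(N, i, Y'', p'', Z') \<in> E" using e' by (auto simp: admissible_epi_def)
  note c = conflation[OF s]
  obtain u where u: "is_iso C Y'' Y' u" "p' \<cdot> u = p''" using pullback_unique[OF pb pb'] .
  have T: "N \<in> Ob C" "Y'' \<in> Ob C" "Y' \<in> Ob C" "Z' \<in> Ob C" using c a by (auto simp: arr_def)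
  have ui: "arrow u Y'' Y'" using u T by (auto simp: is_iso_def arr_def)
  have "(N, u \<cdot> i, Y', p', Z') \<in> E"
    using conflation_transport[OF s arr_comp[OF c(1) ui] a(3) is_iso_id[OF T(1)] u(1) is_iso_id[OF T(4)]]
      u(2) id_r[OF arr_comp[OF c(1) ui]] id_l[OF c(2)] by simp
  then show ?thesis by (auto simp: admissible_epi_def)
qed

text \<open>The cokernel of an identity is a zero object. What is needed of it is that morphisms into it
  are unique, so that squares over it commute automatically.\<close>

lemma ex_deflation_to_zero:
  assumes N: "N \<in> Ob C"
  obtains p Z where "admissible_epi E N p Z" "arrow p N Z"
    "\<And>T f g. arrow f T Z \<Longrightarrow> arrow g T Z \<Longrightarrow> f = g"
proof -
  obtain p Z where s: "(N, Idn C N, N, p, Z) \<in> E"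
    using exact N unfolding exact_structure_def admissible_mono_def by metis
  note c = conflation[OF s]
  have Z: "Z \<in> Ob C" using c by (simp add: arr_def)
  have p0: "p = zero_mor C N Z" using c id_r[OF c(2)] by (simp add: is_cokernel_def)
  have "Idn C Z = zero_mor C Z Z"
  proof -
    have "p \<cdot> Idn C N = zero_mor C N Z" using p0 id_r[OF c(2)] by simp
    then have "\<exists>!g. g \<in> Mor C Z Z \<and> g \<cdot> p = p" using c(2,4) Z by (simp add: is_cokernel_def arr_def)
    moreover have "Idn C Z \<cdot> p = p" "zero_mor C Z Z \<cdot> p = p"
      using id_l[OF c(2)] zero_comp[OF c(2) Z] p0 by simp_all
    ultimately show ?thesis using arr_id[OF Z] arr_zero[OF Z Z] arr_ob(3) by metis
  qed
  then have "f = zero_mor C T Z" if "arrow f T Z" for f T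
    using id_l[OF that] zero_comp[OF that Z] by simp
  then show thesis using that[of p Z] s c by (auto simp: admissible_epi_def)
qed

text \<open>A product of \<open>N\<close> and \<open>M\<close>, given by its universal property, is a pullback of the deflation from \<open>N\<close> to a zero object
  along the zero morphism from \<open>M\<close>.\<close>

lemma deflation_projection:
  assumes "arrow r X N" "arrow p X M"
    and "\<And>T u v. arrow u T N \<Longrightarrow> arrow v T M \<Longrightarrow> \<exists>t. arrow t T X \<and> r \<cdot> t = u \<and> p \<cdot> t = v"
    and "\<And>T s t. arrow s T X \<Longrightarrow> arrow t T X \<Longrightarrow> r \<cdot> s = r \<cdot> t \<Longrightarrow> p \<cdot> s = p \<cdot> t \<Longrightarrow> s = t"
  shows "admissible_epi E X p M"
proof -
  obtain q Z where q: "admissible_epi E N q Z" "arrow q N Z"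
    and uni: "\<And>T f g. arrow f T Z \<Longrightarrow> arrow g T Z \<Longrightarrow> f = g"
    using ex_deflation_to_zero arr_ob(2)[OF assms(1)] by metis
  have f: "arrow (zero_mor C M Z) M Z" using arr_zero assms(2) q(2) by (simp add: arr_def)
  have "pullback C N q Z (zero_mor C M Z) M p X r"
    by (rule pullbackI[OF q(2) f assms(2,1)]) (use assms uni arr_comp q(2) f in blast)+
  then show ?thesis using deflation_pullback q(1) by blast
qed

text \<open>The projection of a biproduct is a deflation, and the kernel provided for it may be replaced by
  the inclusion of the other summand.\<close>

lemma split_conflation:
  assumes bp: "biproduct C N M X i s r p"
  shows "(N, i, X, p, M) \<in> E"
proof -
  note a = biproduct_arr[OF bp]
  have "admissible_epi E X p M"
    by (rule deflation_projection[OF a(3,4)]) (use biproduct_factor[OF bp] biproduct_cancel[OF bp] in metis)+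
  then obtain K k where s: "(K, k, X, p, M) \<in> E" by (auto simp: admissible_epi_def)
  then show ?thesis using conflation_change_kernel biproduct_kernel[OF bp] a(1) by blast
qed

text \<open>With \<open>W = Z \<oplus> Z'\<close>, the morphism factors as \<open>d = p \<oplus> id : Y \<oplus> Z' \<rightarrow> W\<close> followed by
  \<open>q = p\<^sub>1 - f p\<^sub>2 : W \<rightarrow> Z\<close>. The first is the pullback of \<open>p\<close> along the projection \<open>p\<^sub>1\<close>; the second is
  itself a projection, because \<open>p\<^sub>2\<close> and \<open>q\<close> also make \<open>W\<close> a product of \<open>Z'\<close> and \<open>Z\<close>.\<close>

lemma deflation_sum:
  assumes e: "admissible_epi E Y p Z" and p: "arrow p Y Z" and f: "arrow f Z' Z"
    and bp: "biproduct C Y Z' S a1 a2 b1 b2"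
  shows "admissible_epi E S ((p \<cdot> b1) \<ominus>\<^bsub>HomSp C S Z\<^esub> (f \<cdot> b2)) Z"
proof -
  note b = biproduct_arr[OF bp]
  have T: "Z \<in> Ob C" "Z' \<in> Ob C" using f by (auto simp: arr_def)
  obtain W i1 i2 p1 p2 where bpW: "biproduct C Z Z' W i1 i2 p1 p2"
    using ex_direct_sum[OF T] by (auto simp: direct_sum_def)
  note w = biproduct_arr[OF bpW]
  obtain d where d: "arrow d S W" "p1 \<cdot> d = p \<cdot> b1" "p2 \<cdot> d = b2"
    using biproduct_factor[OF bpW arr_comp[OF b(3) p] b(4)] .
  have "pullback C Y p Z p1 W d S b1"
  proof (rule pullbackI[OF p w(3) d(1) b(3) d(2)[symmetric]])
    fix T u v assume u: "arrow u T Y" and v: "arrow v T W" and e: "p \<cdot> u = p1 \<cdot> v"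
    obtain t where t: "arrow t T S" "b1 \<cdot> t = u" "b2 \<cdot> t = p2 \<cdot> v"
      using biproduct_factor[OF bp u arr_comp[OF v w(4)]] .
    have "d \<cdot> t = v"
      using biproduct_cancel[OF bpW arr_comp[OF t(1) d(1)] v] assoc[OF t(1) d(1) w(3)]
        assoc[OF t(1) d(1) w(4)] d assoc[OF t(1) b(3) p] t e by simp
    then show "\<exists>t. arrow t T S \<and> b1 \<cdot> t = u \<and> d \<cdot> t = v" using t by blast
  next
    fix T s t assume st: "arrow s T S" "arrow t T S" "b1 \<cdot> s = b1 \<cdot> t" "d \<cdot> s = d \<cdot> t"
    have "b2 \<cdot> s = b2 \<cdot> t"
      using assoc[OF st(1) d(1) w(4)] assoc[OF st(2) d(1) w(4)] d(3) st(4) by simp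
    then show "s = t" using biproduct_cancel[OF bp st(1,2,3)] by simp
  qed
  then have 1: "admissible_epi E S d W" using deflation_pullback e by blast
  note fp = arr_comp[OF w(4) f]
  let ?q = "p1 \<ominus>\<^bsub>HomSp C W Z\<^esub> (f \<cdot> p2)"
  note q = arr_diff[OF w(3) fp]
  have qc: "?q \<cdot> t = (p1 \<cdot> t) \<ominus>\<^bsub>HomSp C T Z\<^esub> (f \<cdot> (p2 \<cdot> t))" if t: "arrow t T W" for t T
    using diff_comp[OF t w(3) fp] assoc[OF t w(4) f] by simp
  \<comment> \<open>A morphism into the sum is recovered from its second component and its image under the difference.\<close>
  have p1c: "p1 \<cdot> t = (?q \<cdot> t) \<oplus>\<^bsub>HomSp C T Z\<^esub> (f \<cdot> (p2 \<cdot> t))" if t: "arrow t T W" for t T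
  proof -
    have T: "T \<in> Ob C" using t by (simp add: arr_def)
    interpret TZ: abelian_group "HomSp C T Z" using abelian_group_hom T \<open>Z \<in> Ob C\<close> by blast
    have "p1 \<cdot> t \<in> Mor C T Z" "f \<cdot> (p2 \<cdot> t) \<in> Mor C T Z"
      using arr_comp[OF t w(3)] arr_comp[OF arr_comp[OF t w(4)] f] by (auto simp: arr_def)
    then show ?thesis unfolding qc[OF t] by (simp add: TZ.minus_eq TZ.a_assoc TZ.l_neg)
  qed
  have 2: "admissible_epi E W ?q Z"
  proof (rule deflation_projection[OF w(4) q])
    fix T u v assume u: "arrow u T Z'" and v: "arrow v T Z"
    note fu = arr_comp[OF u f]
    obtain t where t: "arrow t T W" "p1 \<cdot> t = v \<oplus>\<^bsub>HomSp C T Z\<^esub> (f \<cdot> u)" "p2 \<cdot> t = u"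
      using biproduct_factor[OF bpW arr_add[OF v fu] u] .
    then have "?q \<cdot> t = v" using qc[OF t(1)] add_diff_cancel_right[OF v fu] by simp
    then show "\<exists>t. arrow t T W \<and> p2 \<cdot> t = u \<and> ?q \<cdot> t = v" using t by blast
  next
    fix T s t assume st: "arrow s T W" "arrow t T W" "p2 \<cdot> s = p2 \<cdot> t" "?q \<cdot> s = ?q \<cdot> t"
    then show "s = t" using biproduct_cancel[OF bpW st(1,2)] p1c[OF st(1)] p1c[OF st(2)] by simp
  qed
  have "?q \<cdot> d = (p \<cdot> b1) \<ominus>\<^bsub>HomSp C S Z\<^esub> (f \<cdot> b2)" using qc[OF d(1)] d by simp
  then show ?thesis using 1 2 exact unfolding exact_structure_def by metis
qed

end

section \<open>Conflations on which a valuation is additive\<close>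

definition additive_conflations ::
    "('o, 'm, 'k) lin_cat \<Rightarrow> ('o, 'm) seq set \<Rightarrow> ('o set \<Rightarrow> nat) \<Rightarrow> ('o, 'm) seq set" where
  "additive_conflations C E w = {(N, i, X, p, M) | N i X p M.
    (N, i, X, p, M) \<in> E \<and> w (iso_class C X) = w (iso_class C M) + w (iso_class C N)}"

locale valued_exact_category = exact_category K C E
  for K :: "'k ring" and C :: "('o, 'm, 'k) lin_cat" and E :: "('o, 'm) seq set" +
  fixes w :: "'o set \<Rightarrow> nat"
  assumes val: "valuation C E w"
begin

abbreviation "wt X \<equiv> w (iso_class C X)"

abbreviation "E' \<equiv> additive_conflations C E w"

lemma mem_additive: "(N, i, X, p, M) \<in> E' \<longleftrightarrow> (N, i, X, p, M) \<in> E \<and> wt X = wt M + wt N"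
  by (simp add: additive_conflations_def)

lemma wt_iso: "isomorphic C X Y \<Longrightarrow> wt X = wt Y"
  using iso_class_eq by simp

lemma wt_direct_sum: "direct_sum C M N S \<Longrightarrow> wt S = wt M + wt N"
  using val by (simp add: valuation_def)

lemma wt_conflation:
  assumes s: "(N, i, X, p, M) \<in> E"
  shows "wt X \<le> wt M + wt N"
proof -
  note c = conflation[OF s]
  obtain S where S: "direct_sum C M N S" using ex_direct_sum c by (metis arr_ob(1,2))
  then have "wt X \<le> wt S" using val s unfolding valuation_def by blast
  then show ?thesis using wt_direct_sum[OF S] by simp
qed

lemma valued_exact_category_opposite: "valued_exact_category K (opposite C) (opposite_seqs E) w"
proof -
  have "valuation (opposite C) (opposite_seqs E) w"
    unfolding valuation_def
  proof (intro conjI allI impI)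
    fix N i X p M S
    assume "(N, i, X, p, M) \<in> opposite_seqs E \<and> direct_sum (opposite C) M N S"
    then have "(M, p, X, i, N) \<in> E" "direct_sum C N M S" using direct_sum_commute by auto
    then show "w (iso_class (opposite C) X) \<le> w (iso_class (opposite C) S)"
      unfolding iso_class_opposite using wt_conflation wt_direct_sum by metis
  next
    fix M N S
    assume "direct_sum (opposite C) M N S"
    then show "w (iso_class (opposite C) S) = w (iso_class (opposite C) M) + w (iso_class (opposite C) N)"
      unfolding iso_class_opposite using wt_direct_sum by simp
  qed
  then show ?thesis using exact_category_opposite
    by (simp add: valued_exact_category_def valued_exact_category_axioms_def)
qed

lemma additive_opposite:
  "additive_conflations (opposite C) (opposite_seqs E) w = opposite_seqs E'"
  by (auto simp: additive_conflations_def opposite_seqs_def iso_class_opposite)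

text \<open>The kernel \<open>L\<close> of \<open>p b\<^sub>1 - f b\<^sub>2\<close> on \<open>Y \<oplus> Z'\<close> is isomorphic to \<open>Y'\<close>, so the valuation inequality for that
  conflation bounds \<open>w(Y')\<close> from below, while the pulled back conflation bounds it from above.\<close>

lemma additive_pullback:
  assumes s: "(N, i, Y, p, Z) \<in> E'" and pb: "pullback C Y p Z f Z' p' Y' f'"
    and s': "(N', i', Y', p', Z') \<in> E"
  shows "(N', i', Y', p', Z') \<in> E'" "wt N' = wt N"
proof -
  have sE: "(N, i, Y, p, Z) \<in> E" and ws: "wt Y = wt Z + wt N" using s mem_additive by auto
  note c = conflation[OF sE] and c' = conflation[OF s'] and a = pullback_arr[OF pb]
  have "is_kernel C N' (f' \<cdot> i') Y p Z" using kernel_of_pullback[OF pb c'(3) c'(1)] .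
  then have "isomorphic C N' N" using conflation_change_kernel(2)[OF sE] arr_comp[OF c'(1) a(4)] by blast
  then show N: "wt N' = wt N" by (rule wt_iso)
  have T: "Y \<in> Ob C" "Z' \<in> Ob C" "Y' \<in> Ob C" using a by (auto simp: arr_def)
  obtain S a1 a2 b1 b2 where bp: "biproduct C Y Z' S a1 a2 b1 b2"
    using ex_direct_sum T by (metis direct_sum_def)
  have "admissible_epi E Y p Z" using sE by (auto simp: admissible_epi_def)
  then obtain L l where L: "(L, l, S, (p \<cdot> b1) \<ominus>\<^bsub>HomSp C S Z\<^esub> (f \<cdot> b2), Z) \<in> E"
    using deflation_sum[OF _ a(1,2) bp] unfolding admissible_epi_def by blast
  note cL = conflation[OF L]
  obtain u where "is_iso C L Y' u"
    using pullback_unique[OF pb pullback_kernel_of_difference[OF a(1,2) bp cL(3,1)]] by metis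
  then have "wt L = wt Y'" using wt_iso T cL unfolding isomorphic_def arr_def by metis
  moreover have "wt S = wt Y + wt Z'" using wt_direct_sum bp unfolding direct_sum_def by blast
  moreover have "wt S \<le> wt Z + wt L" using wt_conflation[OF L] .
  moreover have "wt Y' \<le> wt Z' + wt N'" using wt_conflation[OF s'] .
  ultimately have "wt Y' = wt Z' + wt N'" using ws N by linarith
  then show "(N', i', Y', p', Z') \<in> E'" using s' mem_additive by simp
qed

text \<open>The kernel of the composite is an extension of the kernel \<open>B\<close> of \<open>q\<close> by the kernel \<open>A\<close> of \<open>p\<close>, so its
  weight is at most \<open>w(B) + w(A)\<close>. This is the difference \<open>w(X) - w(Z)\<close>, a lower bound
  by the valuation inequality for the composite.\<close>

lemma additive_comp:
  assumes "admissible_epi E' X p Y" and "admissible_epi E' Y q Z"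
  shows "admissible_epi E' X (q \<cdot> p) Z"
proof -
  obtain A i where s: "(A, i, X, p, Y) \<in> E'" using assms(1) by (auto simp: admissible_epi_def)
  obtain B j where t: "(B, j, Y, q, Z) \<in> E'" using assms(2) by (auto simp: admissible_epi_def)
  have sE: "(A, i, X, p, Y) \<in> E" "wt X = wt Y + wt A" and tE: "(B, j, Y, q, Z) \<in> E" "wt Y = wt Z + wt B"
    using s t mem_additive by auto
  note c = conflation[OF sE(1)] and d = conflation[OF tE(1)]
  have "admissible_epi E X p Y" "admissible_epi E Y q Z"
    using sE tE by (auto simp: admissible_epi_def)
  then have "admissible_epi E X (q \<cdot> p) Z" and
    "\<exists>p' D f. pullback C X p Y j B p' D f \<and> admissible_epi E D p' B"
    using exact d unfolding exact_structure_def arr_def by (metis, metis)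
  then obtain D' k p' D f A' i' where D': "(D', k, X, q \<cdot> p, Z) \<in> E"
    and pb: "pullback C X p Y j B p' D f" and A': "(A', i', D, p', B) \<in> E"
    unfolding admissible_epi_def by metis
  have "wt A' = wt A" using additive_pullback(2)[OF s pb A'] .
  moreover have "wt D \<le> wt B + wt A'" using wt_conflation[OF A'] .
  moreover have "isomorphic C D D'"
    using conflation_change_kernel(2)[OF D' pullback_of_kernel[OF pb d(3,2)] pullback_arr(4)[OF pb]] .
  then have "wt D = wt D'" by (rule wt_iso)
  moreover have "wt X \<le> wt Z + wt D'" using wt_conflation[OF D'] .
  ultimately have "wt X = wt Z + wt D'" using sE tE by linarith
  then show ?thesis using D' mem_additive by (auto simp: admissible_epi_def)
qed

lemma additive_epi_pullback:
  assumes "Z' \<in> Ob C" "f \<in> Mor C Z' Z" "admissible_epi E' Y p Z"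
  shows "\<exists>p' Y' f'. pullback C Y p Z f Z' p' Y' f' \<and> admissible_epi E' Y' p' Z'"
proof -
  obtain N i where s: "(N, i, Y, p, Z) \<in> E'" using assms(3) by (auto simp: admissible_epi_def)
  then have "admissible_epi E Y p Z" using mem_additive by (auto simp: admissible_epi_def)
  then obtain p' Y' f' where pb: "pullback C Y p Z f Z' p' Y' f'" and "admissible_epi E Y' p' Z'"
    using exact assms(1,2) unfolding exact_structure_def by metis
  then show ?thesis using additive_pullback(1)[OF s pb] unfolding admissible_epi_def by metis
qed

lemma split_additive: "E_add C \<subseteq> E'"
proof
  fix t assume "t \<in> E_add C"
  then obtain N i X p M r s where t: "t = (N, i, X, p, M)" and bp: "biproduct C N M X i s r p"
    by (auto simp: E_add_def)
  have "wt X = wt N + wt M" using wt_direct_sum bp unfolding direct_sum_def by blast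
  then show "t \<in> E'" using split_conflation[OF bp] mem_additive t by simp
qed

text \<open>The kernel of the identity is a zero object, so this conflation is split, and split conflations are
  additive by the second property of a valuation.\<close>

lemma additive_id_epi:
  assumes A: "A \<in> Ob C"
  shows "admissible_epi E' A (Idn C A) A"
proof -
  obtain Z i where s: "(Z, i, A, Idn C A, A) \<in> E"
    using exact A unfolding exact_structure_def admissible_epi_def by metis
  note c = conflation[OF s]
  have Z: "Z \<in> Ob C" using c by (simp add: arr_def)
  have k: "is_kernel C Z i A (Idn C A) A" by fact
  have i0: "i = zero_mor C Z A" using k id_l[OF c(1)] by (simp add: is_kernel_def)
  have idZ: "Idn C Z = zero_mor C Z Z"
    using kernel_cancel[OF k c(1) c(2) arr_id[OF Z] arr_zero[OF Z Z]] i0 id_r[OF c(1)] comp_zero[OF c(1) Z] by simp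
  have "biproduct C Z A A i (Idn C A) (zero_mor C A Z) (Idn C A)"
  proof -
    interpret AA: abelian_group "HomSp C A A" using abelian_group_hom A by blast
    show ?thesis
      using A Z arr_id[OF A] arr_zero[OF A Z] arr_zero[OF Z A] id_l[OF arr_id[OF A]] id_r[OF arr_zero[OF A Z]]
        zero_comp[OF arr_zero[OF Z A] Z] id_l[OF c(1)] idZ zero_comp[OF arr_zero[OF A Z] A] i0
      unfolding biproduct_def arr_def by simp
  qed
  then have "(Z, i, A, Idn C A, A) \<in> E_add C" by (auto simp: E_add_def)
  then show ?thesis using split_additive by (auto simp: admissible_epi_def)
qed

text \<open>Each axiom on inflations is the corresponding statement on deflations for the opposite category.\<close>

theorem exact_additive: "exact_structure C E'"
proof -
  interpret op: valued_exact_category K "opposite C" "opposite_seqs E" w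
    by (rule valued_exact_category_opposite)
  have 1: "E' \<subseteq> kernel_cokernel_pairs C" using pairs by (auto simp: additive_conflations_def)
  have 2: "t \<in> E'" if "s \<in> E'" "t \<in> kernel_cokernel_pairs C" "seq_iso C s t" for s t
  proof -
    obtain X i Y p Z where s: "s = (X, i, Y, p, Z)" by (metis prod_cases5)
    obtain X' i' Y' p' Z' where t: "t = (X', i', Y', p', Z')" by (metis prod_cases5)
    have "s \<in> E" using that s mem_additive by simp
    then have tE: "t \<in> E" using exact that by (auto simp: exact_structure_def)
    have "X \<in> Ob C" "Y \<in> Ob C" "Z \<in> Ob C" "X' \<in> Ob C" "Y' \<in> Ob C" "Z' \<in> Ob C"
      using 1 that s t by (auto simp: kernel_cokernel_pairs_def)
    then have "isomorphic C X X'" "isomorphic C Y Y'" "isomorphic C Z Z'"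
      using that(3) s t by (auto simp: seq_iso_def isomorphic_def)
    then have "wt X' = wt X" "wt Y' = wt Y" "wt Z' = wt Z" using wt_iso by simp_all
    then show ?thesis using that(1) tE s t mem_additive by simp
  qed
  have 3: "admissible_epi E' X (q \<cdot> p) Z" if "admissible_epi E' X p Y" "admissible_epi E' Y q Z" for X p Y q Z
    using additive_comp that by blast
  have 4: "admissible_mono E' X (j \<cdot> i) Z" if "admissible_mono E' X i Y" "admissible_mono E' Y j Z" for X i Y j Z
    using op.additive_comp[of Z j Y i X] that by (simp add: additive_opposite)
  have 5: "admissible_mono E' A (Idn C A) A" if "A \<in> Ob C" for A
    using op.additive_id_epi[of A] that by (simp add: additive_opposite)
  have 6: "\<exists>i' Y' f'. pushout C X i Y f X' i' Y' f' \<and> admissible_mono E' X' i' Y'"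
    if "X' \<in> Ob C" "f \<in> Mor C X X'" "admissible_mono E' X i Y" for X' f X i Y
    using op.additive_epi_pullback[of X' f X Y i] that by (simp add: additive_opposite)
  show ?thesis
    unfolding exact_structure_def
    by (intro conjI allI ballI impI; (elim conjE)?)
      (rule 1 2 3 4 5 6 additive_id_epi additive_epi_pullback; assumption)+
qed

end

section \<open>Algebras with a filtered basis\<close>

lemma lookup_hall_scale [simp]:
  "Poly_Mapping.lookup (hall_scale q f) b = q * Poly_Mapping.lookup f b"
  by (simp add: hall_scale_def Poly_Mapping.map.rep_eq when_def)

interpretation hall: Modules.module hall_scale
  by unfold_locales (auto intro!: poly_mapping_eqI simp: lookup_add algebra_simps)

lemma subspace_keys: "hall.subspace {f. Poly_Mapping.keys f \<subseteq> S}"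
  unfolding hall.subspace_def
proof (intro conjI ballI allI)
  fix x y :: "'a set \<Rightarrow>\<^sub>0 rat" assume "x \<in> {f. Poly_Mapping.keys f \<subseteq> S}" "y \<in> {f. Poly_Mapping.keys f \<subseteq> S}"
  then show "x + y \<in> {f. Poly_Mapping.keys f \<subseteq> S}" using Poly_Mapping.keys_add[of x y] by blast
next
  fix c and x :: "'a set \<Rightarrow>\<^sub>0 rat" assume "x \<in> {f. Poly_Mapping.keys f \<subseteq> S}"
  then show "hall_scale c x \<in> {f. Poly_Mapping.keys f \<subseteq> S}" by (auto simp: in_keys_iff subset_iff)
qed simp

definition basis_product :: "('o set \<Rightarrow> 'o set \<Rightarrow> ('o set \<Rightarrow>\<^sub>0 rat)) \<Rightarrow>
    ('o set \<Rightarrow>\<^sub>0 rat) \<Rightarrow> ('o set \<Rightarrow>\<^sub>0 rat) \<Rightarrow> ('o set \<Rightarrow>\<^sub>0 rat)" where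
  "basis_product m f g =
    (\<Sum>a \<in> Poly_Mapping.keys f. \<Sum>c \<in> Poly_Mapping.keys g.
      hall_scale (Poly_Mapping.lookup f a * Poly_Mapping.lookup g c) (m a c))"

definition basis_algebra :: "'o set set \<Rightarrow> ('o set \<Rightarrow> 'o set \<Rightarrow> ('o set \<Rightarrow>\<^sub>0 rat)) \<Rightarrow> 'o set \<Rightarrow>
    (rat, 'o set \<Rightarrow>\<^sub>0 rat) module" where
  "basis_algebra I m u =
    \<lparr>carrier = {f. Poly_Mapping.keys f \<subseteq> I}, monoid.mult = basis_product m,
     one = Poly_Mapping.single u 1, zero = 0, add = (+), smult = hall_scale\<rparr>"

lemma basis_product_superset:
  assumes "finite A" "Poly_Mapping.keys f \<subseteq> A" "finite B" "Poly_Mapping.keys g \<subseteq> B"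
  shows "basis_product m f g =
    (\<Sum>a\<in>A. \<Sum>c\<in>B. hall_scale (Poly_Mapping.lookup f a * Poly_Mapping.lookup g c) (m a c))"
proof -
  have "(\<Sum>a\<in>A. \<Sum>c\<in>B. hall_scale (Poly_Mapping.lookup f a * Poly_Mapping.lookup g c) (m a c))
      = (\<Sum>a\<in>Poly_Mapping.keys f. \<Sum>c\<in>B. hall_scale (Poly_Mapping.lookup f a * Poly_Mapping.lookup g c) (m a c))"
    using assms by (intro sum.mono_neutral_right) (auto simp: in_keys_iff)
  also have "\<dots> = basis_product m f g" unfolding basis_product_def
    using assms by (intro sum.cong sum.mono_neutral_right) (auto simp: in_keys_iff)
  finally show ?thesis ..
qed

lemma basis_product_add_left: "basis_product m (f + f') g = basis_product m f g + basis_product m f' g"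
  using basis_product_superset[of "Poly_Mapping.keys f \<union> Poly_Mapping.keys f'" _ "Poly_Mapping.keys g" g m]
  by (simp add: Poly_Mapping.keys_add lookup_add algebra_simps hall.scale_left_distrib sum.distrib)

lemma basis_product_add_right: "basis_product m f (g + g') = basis_product m f g + basis_product m f g'"
  using basis_product_superset[of "Poly_Mapping.keys f" f "Poly_Mapping.keys g \<union> Poly_Mapping.keys g'" _ m]
  by (simp add: Poly_Mapping.keys_add lookup_add algebra_simps hall.scale_left_distrib sum.distrib)

lemma basis_product_diff:
  "basis_product m f g - basis_product m f' g' = basis_product m (f - f') g + basis_product m f' (g - g')"
  using basis_product_add_left[of m "f - f'" f' g] basis_product_add_right[of m f' "g - g'" g'] by simp

text \<open>An algebra with basis \<open>I\<close> and structure constants \<open>m\<close>, in which the degree of a product of basis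
  elements is at most the sum of their degrees; the basis element \<open>u\<close> of degree zero has the role of the
  unit.\<close>

locale filtered_basis =
  fixes I :: "'o set set" and w :: "'o set \<Rightarrow> nat"
    and m :: "'o set \<Rightarrow> 'o set \<Rightarrow> ('o set \<Rightarrow>\<^sub>0 rat)" and u :: "'o set"
  assumes m_degree: "\<And>a c. a \<in> I \<Longrightarrow> c \<in> I \<Longrightarrow> Poly_Mapping.keys (m a c) \<subseteq> {b \<in> I. w b \<le> w a + w c}"
    and u: "u \<in> I" "w u = 0"
begin

text \<open>The strict inequality makes \<open>below n\<close> the term preceding the \<open>n\<close>-th filtration term
  \<open>below (Suc n)\<close>, also for \<open>n = 0\<close>, where it is zero.\<close>

definition below :: "nat \<Rightarrow> ('o set \<Rightarrow>\<^sub>0 rat) set" where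
  "below n = {f. Poly_Mapping.keys f \<subseteq> {a \<in> I. w a < n}}"

definition part :: "nat \<Rightarrow> ('o set \<Rightarrow>\<^sub>0 rat) \<Rightarrow> ('o set \<Rightarrow>\<^sub>0 rat)" where
  "part n f = Poly_Mapping.mapp (\<lambda>b x. x when w b = n) f"

definition coset :: "nat \<Rightarrow> ('o set \<Rightarrow>\<^sub>0 rat) \<Rightarrow> ('o set \<Rightarrow>\<^sub>0 rat) set" where
  "coset n x = {y. y - x \<in> below n}"

abbreviation "H \<equiv> basis_algebra I m u"
abbreviation "F n \<equiv> below (Suc n)"

lemma below_iff: "f \<in> below n \<longleftrightarrow> (\<forall>a. Poly_Mapping.lookup f a \<noteq> 0 \<longrightarrow> a \<in> I \<and> w a < n)"
  by (auto simp: below_def in_keys_iff)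

lemma carrier_iff: "f \<in> carrier H \<longleftrightarrow> (\<forall>a. Poly_Mapping.lookup f a \<noteq> 0 \<longrightarrow> a \<in> I)"
  by (auto simp: basis_algebra_def in_keys_iff)

lemma subspace_below: "hall.subspace (below n)"
  unfolding below_def by (rule subspace_keys)

lemma subspace_carrier: "hall.subspace (carrier H)"
  unfolding basis_algebra_def by (simp add: subspace_keys)

lemma below_mono: "i \<le> j \<Longrightarrow> below i \<subseteq> below j"
  by (force simp: below_iff)

lemma below_carrier: "f \<in> below n \<Longrightarrow> f \<in> carrier H"
  by (auto simp: below_iff carrier_iff)

lemma below_0: "below 0 = {0}"
  by (auto simp: below_iff intro!: poly_mapping_eqI)

lemma H_simps [simp]:
  "monoid.mult H = basis_product m" "one H = Poly_Mapping.single u 1" "zero H = 0"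
  "add H = (+)" "Module.smult H = hall_scale"
  by (simp_all add: basis_algebra_def)

lemma lookup_part [simp]: "Poly_Mapping.lookup (part n f) b = (Poly_Mapping.lookup f b when w b = n)"
  by (simp add: part_def lookup_mapp when_def in_keys_iff)

lemma part_add: "part n (f + g) = part n f + part n g"
  by (rule poly_mapping_eqI) (simp add: lookup_add when_def)

lemma part_scale: "part n (hall_scale c f) = hall_scale c (part n f)"
  by (rule poly_mapping_eqI) (simp add: when_def)

lemma part_zero: "part n 0 = 0"
  by (rule poly_mapping_eqI) (simp add: when_def)

lemma part_sum: "part n (\<Sum>a\<in>A. f a) = (\<Sum>a\<in>A. part n (f a))"
  by (induction A rule: infinite_finite_induct) (simp_all add: part_add part_zero)

lemma part_part: "part n (part k f) = (if n = k then part n f else 0)"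
  by (rule poly_mapping_eqI) (auto simp: when_def)

lemma part_in: "f \<in> carrier H \<Longrightarrow> part n f \<in> F n"
  by (auto simp: carrier_iff below_iff when_def)

lemma part_rest: "f \<in> F n \<Longrightarrow> f - part n f \<in> below n"
  by (auto simp: below_iff lookup_minus when_def less_Suc_eq)

text \<open>A nonzero product requires \<open>i\<close> and \<open>j\<close> to be positive, and then its degrees are at most
  \<open>(i - 1) + (j - 1)\<close>. The truncated bound covers the degenerate cases, where a factor is zero.\<close>

lemma product_below:
  assumes f: "f \<in> below i" and g: "g \<in> below j"
  shows "basis_product m f g \<in> below (i + j - 1)"
  unfolding basis_product_def
proof (intro hall.subspace_sum[OF subspace_below] hall.subspace_scale[OF subspace_below])
  fix a c assume "a \<in> Poly_Mapping.keys f" "c \<in> Poly_Mapping.keys g"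
  then have "a \<in> I" "w a < i" "c \<in> I" "w c < j" using f g by (auto simp: below_def)
  then show "m a c \<in> below (i + j - 1)" using m_degree[of a c] by (fastforce simp: below_def)
qed

lemma coset_self: "x \<in> coset n x"
  using hall.subspace_0[OF subspace_below] by (simp add: coset_def)

lemma coset_eq_iff: "coset n x = coset n y \<longleftrightarrow> x - y \<in> below n"
proof
  assume "coset n x = coset n y"
  then have "x \<in> coset n y" using coset_self by blast
  then show "x - y \<in> below n" by (simp add: coset_def)
next
  assume *: "x - y \<in> below n"
  have "z - x \<in> below n \<longleftrightarrow> z - y \<in> below n" for z
  proof
    assume "z - x \<in> below n"
    from hall.subspace_add[OF subspace_below this *] show "z - y \<in> below n" by simp
  next
    assume "z - y \<in> below n"
    from hall.subspace_diff[OF subspace_below this *] show "z - x \<in> below n" by simp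
  qed
  then show "coset n x = coset n y" by (simp add: coset_def)
qed

lemma coset_carrier: "x \<in> carrier H \<Longrightarrow> y \<in> coset n x \<Longrightarrow> y \<in> carrier H"
  using hall.subspace_add[OF subspace_carrier, of "y - x" x] below_carrier by (auto simp: coset_def)

lemma coset_zero: "coset n 0 = below n"
  by (simp add: coset_def)

lemma abelian_group_H: "abelian_group H"
proof (rule abelian_groupI)
  fix x assume "x \<in> carrier H"
  then show "\<exists>y\<in>carrier H. y \<oplus>\<^bsub>H\<^esub> x = \<zero>\<^bsub>H\<^esub>"
    using hall.subspace_neg[OF subspace_carrier] by (intro bexI[of _ "- x"]) auto
qed (use hall.subspace_0[OF subspace_carrier] hall.subspace_add[OF subspace_carrier] in \<open>auto simp: ac_simps\<close>)

lemma prev_eq: "prev H F = below"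
  by (rule ext) (simp add: prev_def below_0 split: nat.split)

lemma gr_class_eq: "gr_class H F n x = coset n x"
proof -
  have "gr_class H F n x = {h + x | h. h \<in> below n}"
    by (auto simp: gr_class_def prev_eq a_r_coset_def')
  also have "\<dots> = coset n x"
    unfolding coset_def by (auto, metis diff_add_cancel)
  finally show ?thesis .
qed

lemma finsum_eq_sum:
  assumes "finite A" "\<And>i. i \<in> A \<Longrightarrow> z i \<in> carrier H"
  shows "finsum H z A = (\<Sum>i\<in>A. z i)"
proof -
  interpret abelian_group H by (rule abelian_group_H)
  show ?thesis using assms
  proof (induction A rule: finite_induct)
    case empty then show ?case by simp
  next
    case (insert x A)
    have "finsum H z (insert x A) = z x \<oplus>\<^bsub>H\<^esub> finsum H z A"
      by (rule finsum_insert) (use insert in auto)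
    then show ?case using insert by simp
  qed
qed

theorem algebra_filtration_below: "algebra_filtration H F"
  unfolding algebra_filtration_def
proof (intro conjI allI ballI)
  interpret abelian_group H by (rule abelian_group_H)
  have neg: "inv\<^bsub>add_monoid H\<^esub> x = - x" if "x \<in> carrier H" for x
    using minus_equality[of "- x" x] that hall.subspace_neg[OF subspace_carrier that] by (simp add: a_inv_def)
  show "subgroup (F n) (add_monoid H)" for n
  proof (rule group.subgroupI[OF a_group])
    show "F n \<subseteq> carrier (add_monoid H)" using below_carrier by auto
    show "F n \<noteq> {}" using hall.subspace_0[OF subspace_below] by blast
    show "inv\<^bsub>add_monoid H\<^esub> a \<in> F n" if "a \<in> F n" for a
      using neg[OF below_carrier[OF that]] hall.subspace_neg[OF subspace_below that] by simp
    show "a \<otimes>\<^bsub>add_monoid H\<^esub> b \<in> F n" if "a \<in> F n" "b \<in> F n" for a b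
      using hall.subspace_add[OF subspace_below that] by simp
  qed
  show "c \<odot>\<^bsub>H\<^esub> x \<in> F n" if "x \<in> F n" for n c x using hall.subspace_scale[OF subspace_below that] by simp
  show "F n \<subseteq> F (Suc n)" for n by (rule below_mono) simp
  show "\<Union> (range F) = carrier H"
  proof (intro equalityI subsetI)
    fix f assume f: "f \<in> carrier H"
    have "f \<in> F (Max (w ` Poly_Mapping.keys f))"
      unfolding below_def using f by (auto simp: basis_algebra_def less_Suc_eq_le)
    then show "f \<in> \<Union> (range F)" by blast
  qed (use below_carrier in auto)
  show "\<one>\<^bsub>H\<^esub> \<in> F 0" using u by (simp add: below_def)
  show "x \<otimes>\<^bsub>H\<^esub> y \<in> F (i + j)" if "x \<in> F i" "y \<in> F j" for i j x y
    using product_below[OF that] by simp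
qed

text \<open>The linear map that sends a basis element to its class in the graded piece of its own degree.\<close>

definition graded_map :: "('o set \<Rightarrow>\<^sub>0 rat) \<Rightarrow> nat \<Rightarrow> ('o set \<Rightarrow>\<^sub>0 rat) set" where
  "graded_map f n = coset n (part n f)"

text \<open>Changing the factors within their cosets changes the product by
  \<open>(a - x) b + x (b - y)\<close>, both summands of which have degree below \<open>i + j\<close>.\<close>

lemma rcoset_mult_coset:
  assumes x: "x \<in> F i" and y: "y \<in> F j" and n: "n = i + j"
  shows "rcoset_mult H (below n) (coset i x) (coset j y) = coset n (basis_product m x y)"
proof -
  have eq: "coset n (basis_product m a b) = coset n (basis_product m x y)"
    if a: "a \<in> coset i x" and b: "b \<in> coset j y" for a b
  proof -
    have d: "a - x \<in> below i" "b - y \<in> below j" using a b by (auto simp: coset_def)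
    have "b - y \<in> F j" using d below_mono[of j "Suc j"] by auto
    then have "b \<in> F j" using hall.subspace_add[OF subspace_below _ y, of "b - y"] by simp
    then have "basis_product m (a - x) b + basis_product m x (b - y) \<in> below n"
      using product_below[OF d(1), of b "Suc j"] product_below[OF x d(2)] n
      by (intro hall.subspace_add[OF subspace_below]) simp_all
    then show ?thesis by (simp add: coset_eq_iff basis_product_diff)
  qed
  have "rcoset_mult H (below n) (coset i x) (coset j y)
      = (\<Union>a\<in>coset i x. \<Union>b\<in>coset j y. coset n (basis_product m a b))"
    unfolding rcoset_mult_def using gr_class_eq by (simp add: gr_class_def prev_eq)
  also have "\<dots> = (\<Union>a\<in>coset i x. \<Union>b\<in>coset j y. coset n (basis_product m x y))"
    using eq by simp
  also have "\<dots> = coset n (basis_product m x y)"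
    using coset_self[of x i] coset_self[of y j] by blast
  finally show ?thesis .
qed

text \<open>All \<open>n + 1\<close> summands range over cosets of the same subspace, so their sums fill the coset of the sum
  of representatives.\<close>

lemma graded_mult:
  assumes f: "f \<in> carrier H" and g: "g \<in> carrier H"
  shows "{finsum H z {..n} | z. \<forall>i\<le>n. z i \<in> rcoset_mult H (below n) (graded_map f i) (graded_map g (n - i))}
    = coset n (\<Sum>i\<le>n. basis_product m (part i f) (part (n - i) g))" (is "?L = coset n (\<Sum>i\<le>n. ?p i)")
proof -
  have r: "rcoset_mult H (below n) (graded_map f i) (graded_map g (n - i)) = coset n (?p i)" if "i \<le> n" for i
    unfolding graded_map_def using rcoset_mult_coset[OF part_in[OF f] part_in[OF g], of n i "n - i"] that by simp
  have pc: "?p i \<in> carrier H" for i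
    using product_below[OF part_in[OF f] part_in[OF g]] below_carrier by blast
  show ?thesis
  proof (intro equalityI subsetI)
    fix s assume "s \<in> ?L"
    then obtain z where s: "s = finsum H z {..n}" and z: "\<And>i. i \<le> n \<Longrightarrow> z i \<in> coset n (?p i)"
      using r by auto
    have "s = (\<Sum>i\<le>n. z i)" unfolding s by (rule finsum_eq_sum) (use z coset_carrier[OF pc] in auto)
    moreover have "(\<Sum>i\<le>n. z i - ?p i) \<in> below n"
      by (rule hall.subspace_sum[OF subspace_below]) (use z in \<open>auto simp: coset_def\<close>)
    ultimately show "s \<in> coset n (\<Sum>i\<le>n. ?p i)" by (simp add: coset_def sum_subtractf)
  next
    fix s assume s: "s \<in> coset n (\<Sum>i\<le>n. ?p i)"
    \<comment> \<open>The whole deviation from the sum of the representatives is put into the summand of index 0.\<close>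
    define z where "z = (\<lambda>i. if i = 0 then ?p 0 + (s - (\<Sum>i\<le>n. ?p i)) else ?p i)"
    have z: "z i \<in> coset n (?p i)" for i
      using s coset_self by (auto simp: z_def coset_def)
    have "finsum H z {..n} = (\<Sum>i\<le>n. z i)"
      by (rule finsum_eq_sum) (use z coset_carrier[OF pc] in auto)
    also have "\<dots> = z 0 + (\<Sum>i\<in>{..n} - {0}. z i)" by (simp add: sum.remove)
    also have "\<dots> = z 0 + (\<Sum>i\<in>{..n} - {0}. ?p i)" by (simp add: z_def)
    also have "\<dots> = s - (\<Sum>i\<le>n. ?p i) + (?p 0 + (\<Sum>i\<in>{..n} - {0}. ?p i))" by (simp add: z_def)
    also have "?p 0 + (\<Sum>i\<in>{..n} - {0}. ?p i) = (\<Sum>i\<le>n. ?p i)" by (rule sum.remove[symmetric]) auto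
    finally have "s = finsum H z {..n}" by simp
    then show "s \<in> ?L" using z r by auto
  qed
qed

text \<open>Expand both products over pairs of basis elements. A pair \<open>(a, c)\<close> occurs in the sum over \<open>i\<close> only for
  \<open>i = w a\<close>, and only if \<open>w a + w c = n\<close>; there \<open>m a c\<close> differs from its part of degree \<open>n\<close> by terms of lower
  degree.\<close>

lemma part_product_top_degree:
  assumes m': "\<And>a c. a \<in> I \<Longrightarrow> c \<in> I \<Longrightarrow> m' a c = part (w a + w c) (m a c)"
    and f: "f \<in> carrier H" and g: "g \<in> carrier H"
  shows "part n (basis_product m' f g) - (\<Sum>i\<le>n. basis_product m (part i f) (part (n - i) g)) \<in> below n"
proof -
  let ?K = "Poly_Mapping.keys f" and ?L = "Poly_Mapping.keys g"
  let ?q = "\<lambda>a c. Poly_Mapping.lookup f a * Poly_Mapping.lookup g c"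
  have KI: "a \<in> I" if "a \<in> ?K" for a using that f by (auto simp: basis_algebra_def)
  have LI: "c \<in> I" if "c \<in> ?L" for c using that g by (auto simp: basis_algebra_def)
  have "(\<Sum>i\<le>n. basis_product m (part i f) (part (n - i) g))
      = (\<Sum>i\<le>n. \<Sum>a\<in>?K. \<Sum>c\<in>?L. if w a = i \<and> w c = n - i then hall_scale (?q a c) (m a c) else 0)"
  proof (rule sum.cong[OF refl])
    fix i
    have "basis_product m (part i f) (part (n - i) g) = (\<Sum>a\<in>?K. \<Sum>c\<in>?L.
        hall_scale (Poly_Mapping.lookup (part i f) a * Poly_Mapping.lookup (part (n - i) g) c) (m a c))"
      by (rule basis_product_superset) (auto simp: in_keys_iff when_def split: if_splits)
    also have "\<dots> = (\<Sum>a\<in>?K. \<Sum>c\<in>?L. if w a = i \<and> w c = n - i then hall_scale (?q a c) (m a c) else 0)"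
      by (intro sum.cong refl) (auto simp: when_def)
    finally show "basis_product m (part i f) (part (n - i) g) = \<dots>" .
  qed
  also have "\<dots> = (\<Sum>a\<in>?K. \<Sum>c\<in>?L. \<Sum>i\<le>n. if w a = i \<and> w c = n - i then hall_scale (?q a c) (m a c) else 0)"
    by (subst sum.swap, rule sum.cong[OF refl], subst sum.swap, rule refl)
  also have "\<dots> = (\<Sum>a\<in>?K. \<Sum>c\<in>?L. if w a + w c = n then hall_scale (?q a c) (m a c) else 0)"
  proof (intro sum.cong refl)
    fix a c
    have "(\<Sum>i\<le>n. if w a = i \<and> w c = n - i then hall_scale (?q a c) (m a c) else 0)
       = (\<Sum>i\<le>n. if i = w a then (if w a + w c = n then hall_scale (?q a c) (m a c) else 0) else 0)"
      by (intro sum.cong refl) auto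
    also have "\<dots> = (if w a + w c = n then hall_scale (?q a c) (m a c) else 0)" by auto
    finally show "(\<Sum>i\<le>n. if w a = i \<and> w c = n - i then hall_scale (?q a c) (m a c) else 0) = \<dots>" .
  qed
  finally have 1: "(\<Sum>i\<le>n. basis_product m (part i f) (part (n - i) g)) = \<dots>" .
  have 2: "part n (basis_product m' f g) =
      (\<Sum>a\<in>?K. \<Sum>c\<in>?L. hall_scale (?q a c) (if w a + w c = n then part n (m a c) else 0))"
    unfolding basis_product_def part_sum part_scale
    using m' KI LI by (intro sum.cong refl) (auto simp: part_part)
  have "part n (basis_product m' f g) - (\<Sum>i\<le>n. basis_product m (part i f) (part (n - i) g)) =
      (\<Sum>a\<in>?K. \<Sum>c\<in>?L. if w a + w c = n then hall_scale (?q a c) (- (m a c - part n (m a c))) else 0)"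
    unfolding 1 2 sum_subtractf[symmetric]
    by (intro sum.cong refl) (auto simp: hall.scale_right_diff_distrib)
  moreover have "\<dots> \<in> below n"
  proof (intro hall.subspace_sum[OF subspace_below])
    fix a c assume "a \<in> ?K" "c \<in> ?L"
    then have "m a c \<in> F (w a + w c)" using m_degree[OF KI LI, of a c] by (fastforce simp: below_def less_Suc_eq_le)
    from hall.subspace_scale[OF subspace_below hall.subspace_neg[OF subspace_below part_rest[OF this]]]
    show "(if w a + w c = n then hall_scale (?q a c) (- (m a c - part n (m a c))) else 0) \<in> below n"
      using hall.subspace_0[OF subspace_below] by auto
  qed
  ultimately show ?thesis by simp
qed

lemma graded_map_single:
  assumes b: "b \<in> I"
  shows "graded_map (Poly_Mapping.single b 1) = gr_homogeneous H F (w b) (Poly_Mapping.single b 1)"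
proof
  fix n
  have "part n (Poly_Mapping.single b 1) = (if n = w b then Poly_Mapping.single b 1 else 0)"
    by (rule poly_mapping_eqI) (auto simp: lookup_single when_def)
  then show "graded_map (Poly_Mapping.single b 1) n = gr_homogeneous H F (w b) (Poly_Mapping.single b 1) n"
    by (simp add: graded_map_def gr_homogeneous_def gr_class_eq prev_eq coset_zero)
qed

lemma graded_map_in:
  assumes f: "f \<in> carrier H"
  shows "graded_map f \<in> carrier (assoc_graded H F)"
proof -
  have "n \<in> w ` Poly_Mapping.keys f" if "graded_map f n \<noteq> below n" for n
  proof (rule ccontr)
    assume "n \<notin> w ` Poly_Mapping.keys f"
    then have "part n f = 0" by (intro poly_mapping_eqI) (auto simp: when_def in_keys_iff image_iff)
    then show False using that by (simp add: graded_map_def coset_zero)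
  qed
  then have "{n. graded_map f n \<noteq> below n} \<subseteq> w ` Poly_Mapping.keys f" by (rule subsetI) simp
  then have "finite {n. graded_map f n \<noteq> below n}" by (rule finite_subset) simp
  then show ?thesis
    using part_in[OF f] by (auto simp: assoc_graded_def prev_eq gr_class_eq graded_map_def)
qed

lemma graded_map_bij: "bij_betw graded_map (carrier H) (carrier (assoc_graded H F))"
proof (rule bij_betwI')
  fix f g assume f: "f \<in> carrier H" and g: "g \<in> carrier H"
  show "graded_map f = graded_map g \<longleftrightarrow> f = g"
  proof
    assume e: "graded_map f = graded_map g"
    show "f = g"
    proof (rule poly_mapping_eqI)
      fix b
      have "part (w b) f - part (w b) g \<in> below (w b)"
        using fun_cong[OF e, of "w b"] by (simp add: graded_map_def coset_eq_iff)
      then have "Poly_Mapping.lookup (part (w b) f - part (w b) g) b = 0" by (auto simp: below_iff)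
      then show "Poly_Mapping.lookup f b = Poly_Mapping.lookup g b" by (simp add: lookup_minus)
    qed
  qed simp
next
  fix f assume "f \<in> carrier H"
  then show "graded_map f \<in> carrier (assoc_graded H F)" by (rule graded_map_in)
next
  fix \<xi> assume "\<xi> \<in> carrier (assoc_graded H F)"
  then have x: "\<forall>n. \<exists>x \<in> F n. \<xi> n = coset n x" and fin: "finite {n. \<xi> n \<noteq> below n}"
    by (auto simp: assoc_graded_def prev_eq gr_class_eq)
  from x obtain x where x: "\<And>n. x n \<in> F n" "\<And>n. \<xi> n = coset n (x n)" by metis
  let ?S = "{n. \<xi> n \<noteq> below n}"
  \<comment> \<open>Each coset is represented by the homogeneous part of any of its elements, and only finitely many are nonzero.\<close>
  define f where "f = (\<Sum>n\<in>?S. part n (x n))"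
  have "f \<in> carrier H"
    unfolding f_def using part_in[OF below_carrier[OF x(1)]] below_carrier
    by (intro hall.subspace_sum[OF subspace_carrier]) blast
  moreover have "\<xi> = graded_map f"
  proof
    fix n
    have "part n f = (if n \<in> ?S then part n (x n) else 0)"
      unfolding f_def part_sum part_part using fin by (simp add: sum.delta)
    moreover have "coset n (x n) = coset n (part n (x n))"
      unfolding coset_eq_iff by (rule part_rest[OF x(1)])
    ultimately show "\<xi> n = graded_map f n"
      using x(2)[of n] by (cases "n \<in> ?S") (simp_all add: graded_map_def coset_zero)
  qed
  ultimately show "\<exists>f\<in>carrier H. \<xi> = graded_map f" by blast
qed

lemma set_add_coset: "coset n x <+>\<^bsub>H\<^esub> coset n y = coset n (x + y)"
proof (intro equalityI subsetI)
  fix s assume "s \<in> coset n x <+>\<^bsub>H\<^esub> coset n y"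
  then obtain a b where ab: "a - x \<in> below n" "b - y \<in> below n" "s = a + b"
    by (auto simp: set_add_def' coset_def)
  have "s - (x + y) = (a - x) + (b - y)" using ab(3) by simp
  then show "s \<in> coset n (x + y)"
    using hall.subspace_add[OF subspace_below ab(1,2)] by (simp only: coset_def mem_Collect_eq)
next
  fix s assume s: "s \<in> coset n (x + y)"
  then have "s - y \<in> coset n x" by (simp add: coset_def diff_diff_eq add.commute)
  then show "s \<in> coset n x <+>\<^bsub>H\<^esub> coset n y"
    using coset_self[of y n] by (force simp: set_add_def')
qed

text \<open>In the associated graded algebra, only the part of top degree of a product of basis elements
  survives; so it has the top degree parts of the structure constants.\<close>

theorem graded_map_iso:
  assumes m': "\<And>a c. a \<in> I \<Longrightarrow> c \<in> I \<Longrightarrow> m' a c = part (w a + w c) (m a c)"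
  shows "graded_map \<in> algebra_iso (basis_algebra I m' u) (assoc_graded H F)"
proof -
  let ?H' = "basis_algebra I m' u" and ?G = "assoc_graded H F"
  have c: "carrier ?H' = carrier H" by (simp add: basis_algebra_def)
  have H': "monoid.mult ?H' = basis_product m'" "one ?H' = Poly_Mapping.single u 1" "add ?H' = (+)"
    "Module.smult ?H' = hall_scale" by (simp_all add: basis_algebra_def)
  have "graded_map \<in> ring_hom ?H' ?G"
  proof (rule ring_hom_memI)
    fix f assume "f \<in> carrier ?H'"
    then show "graded_map f \<in> carrier ?G" unfolding c by (rule graded_map_in)
  next
    fix f g assume "f \<in> carrier ?H'" "g \<in> carrier ?H'"
    then have f: "f \<in> carrier H" and g: "g \<in> carrier H" unfolding c .
    show "graded_map (f \<otimes>\<^bsub>?H'\<^esub> g) = graded_map f \<otimes>\<^bsub>?G\<^esub> graded_map g"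
    proof
      fix n
      have "(graded_map f \<otimes>\<^bsub>?G\<^esub> graded_map g) n = {finsum H z {..n} | z.
          \<forall>i\<le>n. z i \<in> rcoset_mult H (below n) (graded_map f i) (graded_map g (n - i))}"
        by (simp add: assoc_graded_def prev_eq)
      also have "\<dots> = coset n (\<Sum>i\<le>n. basis_product m (part i f) (part (n - i) g))"
        by (rule graded_mult[OF f g])
      also have "\<dots> = coset n (part n (basis_product m' f g))"
        using part_product_top_degree[OF m' f g] by (simp only: coset_eq_iff[symmetric])
      finally show "graded_map (f \<otimes>\<^bsub>?H'\<^esub> g) n = (graded_map f \<otimes>\<^bsub>?G\<^esub> graded_map g) n"
        by (simp add: graded_map_def H')
    qed
    show "graded_map (f \<oplus>\<^bsub>?H'\<^esub> g) = graded_map f \<oplus>\<^bsub>?G\<^esub> graded_map g"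
      by (rule ext) (simp add: H' assoc_graded_def graded_map_def set_add_coset part_add)
  next
    show "graded_map \<one>\<^bsub>?H'\<^esub> = \<one>\<^bsub>?G\<^esub>"
      using graded_map_single[OF u(1)] u by (simp add: H' gr_homogeneous_def assoc_graded_def fun_eq_iff)
  qed
  moreover have "graded_map (q \<odot>\<^bsub>?H'\<^esub> f) = q \<odot>\<^bsub>?G\<^esub> graded_map f" for q f
  proof
    fix n
    have "coset n (hall_scale q x) = coset n (hall_scale q (part n f))" if "x \<in> coset n (part n f)" for x
      using that hall.subspace_scale[OF subspace_below, of "x - part n f" n q]
      by (simp add: coset_def[of n "part n f"] coset_eq_iff hall.scale_right_diff_distrib)
    then have "(\<Union>x\<in>coset n (part n f). coset n (hall_scale q x)) = coset n (hall_scale q (part n f))"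
      using coset_self by blast
    then show "graded_map (q \<odot>\<^bsub>?H'\<^esub> f) n = (q \<odot>\<^bsub>?G\<^esub> graded_map f) n"
      by (simp add: H' assoc_graded_def gr_class_eq graded_map_def part_scale)
  qed
  ultimately show ?thesis
    using graded_map_bij by (simp add: algebra_iso_def ring_iso_def c)
qed

end

section \<open>Structure constants of Hall algebras\<close>

context exact_category
begin

lemma rep_in: "a \<in> Iso C \<Longrightarrow> rep a \<in> Ob C \<and> iso_class C (rep a) = a"
proof -
  assume "a \<in> Iso C"
  then obtain A where A: "A \<in> Ob C" "a = iso_class C A" by (auto simp: Iso_def)
  then have "A \<in> a" using isomorphic_refl by (simp add: iso_class_def)
  then have "rep a \<in> a" unfolding rep_def by (rule someI)
  then have i: "isomorphic C A (rep a)" using A by (simp add: iso_class_def)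
  then have "rep a \<in> Ob C" by (simp only: isomorphic_def)
  then show ?thesis using iso_class_eq[OF i] A(2) by metis
qed

lemma Ext1_middle:
  assumes "\<xi> \<in> Ext1 C E A N" and "(i, B, p) \<in> \<xi>" and "(i', B', p') \<in> \<xi>"
  shows "isomorphic C B B'"
proof -
  obtain t where t: "\<xi> = ext_equiv C E A N `` {t}" using assms(1) by (auto simp: Ext1_def quotient_def)
  obtain j D q where t': "t = (j, D, q)" by (metis prod_cases3)
  have *: "isomorphic C D B0" if "(k, B0, r) \<in> \<xi>" for k B0 r
  proof -
    have "(N, j, D, q, A) \<in> E" "(N, k, B0, r, A) \<in> E" and "\<exists>h. is_iso C D B0 h"
      using that t t' by (auto simp: ext_equiv_def extensions_def)
    then show ?thesis using conflation arr_ob unfolding isomorphic_def by metis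
  qed
  show ?thesis using isomorphic_trans[OF isomorphic_sym[OF *[OF assms(2)]] *[OF assms(3)]] .
qed

text \<open>An extension class determines its middle term up to isomorphism, so there are at most as many
  middle terms as extension classes. Without this finiteness the defining sum of the product would have
  the default value zero.\<close>

lemma finite_middle_classes:
  assumes fin: "finite (Ext1 C E A N)"
  shows "finite {b \<in> Iso C. Ext1_mid C E A N (rep b) \<noteq> {}}"
proof (rule finite_subset)
  show "finite ((\<lambda>\<xi>. iso_class C (fst (snd (SOME t. t \<in> \<xi>)))) ` Ext1 C E A N)" using fin by simp
  show "{b \<in> Iso C. Ext1_mid C E A N (rep b) \<noteq> {}}
      \<subseteq> (\<lambda>\<xi>. iso_class C (fst (snd (SOME t. t \<in> \<xi>)))) ` Ext1 C E A N"
  proof clarify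
    fix b assume b: "b \<in> Iso C" "Ext1_mid C E A N (rep b) \<noteq> {}"
    then obtain \<xi> i B p where \<xi>: "\<xi> \<in> Ext1 C E A N" "(i, B, p) \<in> \<xi>" "isomorphic C B (rep b)"
      by (auto simp: Ext1_mid_def)
    obtain i' B' p' where s: "(SOME t. t \<in> \<xi>) = (i', B', p')" by (metis prod_cases3)
    then have "(i', B', p') \<in> \<xi>" using someI[of "\<lambda>t. t \<in> \<xi>", OF \<xi>(2)] by simp
    then have "isomorphic C B' (rep b)" using Ext1_middle[OF \<xi>(1) _ \<xi>(2)] isomorphic_trans \<xi>(3) by blast
    then have "iso_class C B' = b" using iso_class_eq rep_in[OF b(1)] by simp
    then show "b \<in> (\<lambda>\<xi>. iso_class C (fst (snd (SOME t. t \<in> \<xi>)))) ` Ext1 C E A N"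
      using s \<xi>(1) by (intro image_eqI[of _ _ \<xi>]) simp_all
  qed
qed

lemma lookup_hall_basis_mult:
  assumes fin: "finite (Ext1 C E A N)"
  shows "Poly_Mapping.lookup (hall_basis_mult C E A N) b =
    (hall_coeff C E A N (rep b) when b \<in> Iso C)"
proof -
  let ?S = "{b \<in> Iso C. Ext1_mid C E A N (rep b) \<noteq> {}}"
  have "Poly_Mapping.lookup (hall_basis_mult C E A N) b
      = (\<Sum>b'\<in>?S. if b' = b then hall_coeff C E A N (rep b') else 0)"
    unfolding hall_basis_mult_def lookup_sum by (simp add: lookup_single when_def)
  also have "\<dots> = (if b \<in> ?S then hall_coeff C E A N (rep b) else 0)"
    using finite_middle_classes[OF fin] by (simp add: sum.delta)
  finally show ?thesis by (auto simp: hall_coeff_def when_def)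
qed

lemma hall_algebra_basis_algebra:
  "hall_algebra C E = basis_algebra (Iso C) (\<lambda>a c. hall_basis_mult C E (rep a) (rep c))
    (iso_class C (SOME Z. zero_object C Z))"
  by (simp add: hall_algebra_def basis_algebra_def hall_basis_def hall_mult_def basis_product_def fun_eq_iff)

end

context valued_exact_category
begin

text \<open>Equivalent extensions have isomorphic middle terms, so an equivalence class lies in \<open>E'\<close> as soon as one
  of its members does.\<close>

lemma Ext1_class_additive:
  assumes t: "t \<in> extensions E' A N"
  shows "ext_equiv C E' A N `` {t} = ext_equiv C E A N `` {t}"
proof -
  obtain i B p where te: "t = (i, B, p)" by (metis prod_cases3)
  have B: "(N, i, B, p, A) \<in> E" "wt B = wt A + wt N" using t te mem_additive by (auto simp: extensions_def)
  have "(N, i', B', p', A) \<in> E'" if "(N, i', B', p', A) \<in> E" "is_iso C B B' h" for i' B' p' h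
  proof -
    have "isomorphic C B B'" using that B(1) conflation arr_ob unfolding isomorphic_def by metis
    then show ?thesis using wt_iso B(2) that(1) mem_additive by simp
  qed
  moreover have "E' \<subseteq> E" by (auto simp: additive_conflations_def)
  ultimately show ?thesis using t te by (auto simp: ext_equiv_def extensions_def)
qed

lemma Ext1_additive_subset: "Ext1 C E' A N \<subseteq> Ext1 C E A N"
  using Ext1_class_additive mem_additive by (fastforce simp: Ext1_def quotient_def extensions_def)

lemma Ext1_mid_additive:
  "Ext1_mid C E' A N B = (if wt B = wt A + wt N then Ext1_mid C E A N B else {})"
proof -
  have 1: "\<xi> \<in> Ext1_mid C E A N B \<and> wt B = wt A + wt N" if \<xi>: "\<xi> \<in> Ext1_mid C E' A N B" for \<xi>
  proof -
    have "\<xi> \<in> Ext1 C E' A N" using \<xi> by (simp add: Ext1_mid_def)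
    then obtain t where t: "\<xi> = ext_equiv C E' A N `` {t}" by (auto simp: Ext1_def quotient_def)
    obtain i B' p where B': "(i, B', p) \<in> \<xi>" "isomorphic C B' B" using \<xi> by (auto simp: Ext1_mid_def)
    then have "(N, i, B', p, A) \<in> E'" using t by (auto simp: ext_equiv_def extensions_def)
    then have "wt B = wt A + wt N" using mem_additive wt_iso[OF B'(2)] by simp
    then show ?thesis using \<xi> Ext1_additive_subset by (auto simp: Ext1_mid_def)
  qed
  have 2: "\<xi> \<in> Ext1_mid C E' A N B" if \<xi>: "\<xi> \<in> Ext1_mid C E A N B" and eq: "wt B = wt A + wt N" for \<xi>
  proof -
    have \<xi>E: "\<xi> \<in> Ext1 C E A N" using \<xi> by (simp add: Ext1_mid_def)
    then obtain t where t: "\<xi> = ext_equiv C E A N `` {t}" by (auto simp: Ext1_def quotient_def)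
    obtain j D q where te: "t = (j, D, q)" by (metis prod_cases3)
    obtain i B' p where B': "(i, B', p) \<in> \<xi>" "isomorphic C B' B" using \<xi> by (auto simp: Ext1_mid_def)
    then have D: "(N, j, D, q, A) \<in> E" and BE: "(N, i, B', p, A) \<in> E" and "\<exists>h. is_iso C D B' h"
      using t te by (auto simp: ext_equiv_def extensions_def)
    then have "isomorphic C D B'" using conflation arr_ob unfolding isomorphic_def by metis
    then have "wt D = wt A + wt N" using wt_iso[OF B'(2)] wt_iso eq by simp
    then have tE: "t \<in> extensions E' A N" using D te mem_additive by (simp add: extensions_def)
    then have "\<xi> \<in> Ext1 C E' A N" using Ext1_class_additive[OF tE] t by (auto simp: Ext1_def quotient_def)
    then show ?thesis using B' by (auto simp: Ext1_mid_def)
  qed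
  show ?thesis using 1 2 by auto
qed

lemma Ext1_mid_wt:
  assumes "Ext1_mid C E A N B \<noteq> {}"
  shows "wt B \<le> wt A + wt N"
proof -
  obtain \<xi> i B' p where \<xi>: "\<xi> \<in> Ext1 C E A N" "(i, B', p) \<in> \<xi>" "isomorphic C B' B"
    using assms by (auto simp: Ext1_mid_def)
  then have "(N, i, B', p, A) \<in> E" by (auto simp: Ext1_def quotient_def ext_equiv_def extensions_def)
  then show ?thesis using wt_conflation wt_iso[OF \<xi>(3)] by metis
qed

lemma wt_zero_object:
  assumes Z: "zero_object C Z"
  shows "wt Z = 0"
proof -
  have ZO: "Z \<in> Ob C" using Z by (simp add: zero_object_def)
  have uni: "f = g" if "f \<in> Mor C Z Z" "g \<in> Mor C Z Z" for f g
    using Z ZO that unfolding zero_object_def by blast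
  have id: "Idn C Z \<in> Mor C Z Z" and zero: "zero_mor C Z Z \<in> Mor C Z Z"
    using arr_id[OF ZO] arr_zero[OF ZO ZO] by (simp_all add: arr_def)
  note c = arr_comp[OF arr_id[OF ZO] arr_id[OF ZO]]
  have "biproduct C Z Z Z (Idn C Z) (Idn C Z) (Idn C Z) (Idn C Z)"
    unfolding biproduct_def
    using ZO id zero c arr_add[OF c c] uni[OF zero id] by (auto simp: arr_def intro!: uni)
  then have "direct_sum C Z Z Z" unfolding direct_sum_def by blast
  then have "wt Z = wt Z + wt Z" by (rule wt_direct_sum)
  then show ?thesis by simp
qed

text \<open>A structure constant is nonzero only for middle terms of extensions, and the valuation inequality
  bounds their weight.\<close>

lemma hall_filtered_basis:
  assumes fin: "ext1_finite C E"
  shows "filtered_basis (Iso C) w (\<lambda>a c. hall_basis_mult C E (rep a) (rep c))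
    (iso_class C (SOME Z. zero_object C Z))"
proof
  fix a c assume a: "a \<in> Iso C" and c: "c \<in> Iso C"
  then have f: "finite (Ext1 C E (rep a) (rep c))" using fin rep_in by (simp add: ext1_finite_def)
  show "Poly_Mapping.keys (hall_basis_mult C E (rep a) (rep c)) \<subseteq> {b \<in> Iso C. w b \<le> w a + w c}"
  proof
    fix b assume "b \<in> Poly_Mapping.keys (hall_basis_mult C E (rep a) (rep c))"
    then have "b \<in> Iso C" "hall_coeff C E (rep a) (rep c) (rep b) \<noteq> 0"
      by (auto simp: in_keys_iff lookup_hall_basis_mult[OF f])
    moreover from this(2) have "Ext1_mid C E (rep a) (rep c) (rep b) \<noteq> {}" by (auto simp: hall_coeff_def)
    ultimately show "b \<in> {b \<in> Iso C. w b \<le> w a + w c}"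
      using Ext1_mid_wt a c rep_in by fastforce
  qed
next
  have Z: "zero_object C (SOME Z. zero_object C Z)" using ex_zero_object by (rule someI_ex)
  then show "iso_class C (SOME Z. zero_object C Z) \<in> Iso C" by (auto simp: Iso_def zero_object_def)
  show "wt (SOME Z. zero_object C Z) = 0" using wt_zero_object[OF Z] .
qed

lemma hall_filtration_below:
  assumes fin: "ext1_finite C E"
  shows "hall_filtration C w n = filtered_basis.below (Iso C) w (Suc n)"
proof -
  interpret filtered_basis "Iso C" w "\<lambda>a c. hall_basis_mult C E (rep a) (rep c)"
    "iso_class C (SOME Z. zero_object C Z)" by (rule hall_filtered_basis[OF fin])
  let ?B = "{hall_basis C M | M. M \<in> Ob C \<and> wt M \<le> n}"
  have "hall.span ?B = F n"
  proof (rule equalityI)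
    show "hall.span ?B \<subseteq> F n"
    proof (rule hall.span_minimal[OF _ subspace_below], clarify)
      fix M assume M: "M \<in> Ob C" "wt M \<le> n"
      then have "iso_class C M \<in> Iso C" by (simp add: Iso_def)
      then show "hall_basis C M \<in> F n" using M by (auto simp: below_def hall_basis_def)
    qed
    show "F n \<subseteq> hall.span ?B"
    proof
      fix f assume f: "f \<in> F n"
      have "f = (\<Sum>a\<in>Poly_Mapping.keys f. hall_scale (Poly_Mapping.lookup f a) (Poly_Mapping.single a 1))"
        by (rule poly_mapping_eqI) (simp add: lookup_sum lookup_single when_def in_keys_iff sum.delta if_distrib cong: if_cong)
      moreover have "\<dots> \<in> hall.span ?B"
      proof (intro hall.span_sum hall.span_scale hall.span_base)
        fix a assume "a \<in> Poly_Mapping.keys f"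
        then have "a \<in> Iso C" "w a \<le> n" using f by (auto simp: below_def)
        then show "Poly_Mapping.single a 1 \<in> ?B" by (auto simp: Iso_def hall_basis_def)
      qed
      ultimately show "f \<in> hall.span ?B" by simp
    qed
  qed
  then show ?thesis by (simp add: hall_filtration_def)
qed

text \<open>The numerators of the structure constants for \<open>E'\<close> are those for \<open>E\<close> where the weights add up and zero
  elsewhere, and the denominators do not involve the exact structure.\<close>

theorem hall_algebra_degeneration:
  assumes fin: "ext1_finite C E"
  shows "algebra_filtration (hall_algebra C E) (hall_filtration C w)"
    and "\<exists>\<phi> \<in> algebra_iso (hall_algebra C E') (assoc_graded (hall_algebra C E) (hall_filtration C w)).
        \<forall>M \<in> Ob C. \<phi> (hall_basis C M) =
          gr_homogeneous (hall_algebra C E) (hall_filtration C w) (wt M) (hall_basis C M)"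
proof -
  let ?m = "\<lambda>a c. hall_basis_mult C E (rep a) (rep c)" and ?m' = "\<lambda>a c. hall_basis_mult C E' (rep a) (rep c)"
  interpret filtered_basis "Iso C" w ?m "iso_class C (SOME Z. zero_object C Z)"
    by (rule hall_filtered_basis[OF fin])
  interpret additive: exact_category K C E'
    using exact_additive linear_additive_category_axioms
    by (simp add: exact_category_def exact_category_axioms_def)
  have F: "hall_filtration C w = F" using hall_filtration_below[OF fin] by blast
  show "algebra_filtration (hall_algebra C E) (hall_filtration C w)"
    unfolding F hall_algebra_basis_algebra by (rule algebra_filtration_below)
  have m': "?m' a c = part (w a + w c) (?m a c)" if a: "a \<in> Iso C" and c: "c \<in> Iso C" for a c
  proof (rule poly_mapping_eqI)
    fix b
    have f: "finite (Ext1 C E (rep a) (rep c))" using a c fin rep_in by (simp add: ext1_finite_def)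
    have f': "finite (Ext1 C E' (rep a) (rep c))" using f Ext1_additive_subset finite_subset by blast
    have "hall_coeff C E' (rep a) (rep c) (rep b) = (hall_coeff C E (rep a) (rep c) (rep b) when w b = w a + w c)"
      if "b \<in> Iso C"
      using Ext1_mid_additive[of "rep a" "rep c" "rep b"] rep_in[OF a] rep_in[OF c] rep_in[OF that]
      by (simp add: hall_coeff_def when_def)
    then show "Poly_Mapping.lookup (?m' a c) b = Poly_Mapping.lookup (part (w a + w c) (?m a c)) b"
      by (simp add: lookup_hall_basis_mult[OF f] additive.lookup_hall_basis_mult[OF f'] when_def)
  qed
  show "\<exists>\<phi> \<in> algebra_iso (hall_algebra C E') (assoc_graded (hall_algebra C E) (hall_filtration C w)).
        \<forall>M \<in> Ob C. \<phi> (hall_basis C M) =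
          gr_homogeneous (hall_algebra C E) (hall_filtration C w) (wt M) (hall_basis C M)"
  proof (rule bexI)
    show "graded_map \<in> algebra_iso (hall_algebra C E') (assoc_graded (hall_algebra C E) (hall_filtration C w))"
      unfolding F hall_algebra_basis_algebra additive.hall_algebra_basis_algebra
      by (rule graded_map_iso[OF m'])
    show "\<forall>M\<in>Ob C. graded_map (hall_basis C M) =
        gr_homogeneous (hall_algebra C E) (hall_filtration C w) (wt M) (hall_basis C M)"
      unfolding F hall_algebra_basis_algebra hall_basis_def using graded_map_single by (simp add: Iso_def)
  qed
qed

end

section \<open>Degeneration along a valuation\<close>

theorem theorem4:
  fixes K :: "'k ring"
    and C :: "('o, 'm, 'k) lin_cat"
    and E :: "('o, 'm) seq set"
    and w :: "'o set \<Rightarrow> nat"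
  assumes "finite (carrier K)"
    and "linear_additive_category K C"
    and "hom_finite C"
    and "idempotent_complete C"
    and "exact_structure C E"
    and "ext1_finite C E"
    and "valuation C E w"
  shows "algebra_filtration (hall_algebra C E) (hall_filtration C w) \<and>
    (\<exists>E' \<in> exact_interval C (E_add C) E.
      \<exists>\<phi> \<in> algebra_iso (hall_algebra C E')
                (assoc_graded (hall_algebra C E) (hall_filtration C w)).
        \<forall>M \<in> Ob C. \<phi> (hall_basis C M) =
          gr_homogeneous (hall_algebra C E) (hall_filtration C w)
            (w (iso_class C M)) (hall_basis C M))"
proof -
  interpret valued_exact_category K C E w
    using assms by (simp add: valued_exact_category_def valued_exact_category_axioms_def
        exact_category_def exact_category_axioms_def)
  have "additive_conflations C E w \<in> exact_interval C (E_add C) E"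
    using exact_additive split_additive by (auto simp: exact_interval_def additive_conflations_def)
  then show ?thesis using hall_algebra_degeneration[OF assms(6)] by blast
qed

end
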